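(* Let $\mathbb{K}$ be a field and let $p_i,q_i,\lambda_i,\mu_i\in\mathbb{K}^{\ast}$ for $i=1,2$. Assume that none of $p_1,p_2,q_1,q_2$ is a root of unity. Then the polynomial extension $\mathcal{A}_{p_1}(\lambda_1,\mu_1,\mathbb{K}_{q_1}[s,t])[w]$ is isomorphic to $\mathcal{A}_{p_2}(\lambda_2,\mu_2,\mathbb{K}_{q_2}[s,t])[w]$ as a $\mathbb{K}$-algebra if and only if one of the following holds: (i) $p_1=p_2,\ q_1=q_2,\ \lambda_1=\lambda_2,\ \mu_1=\mu_2$; (ii) $p_1=p_2^{-1},\ q_1=q_2,\ \lambda_1=\lambda_2^{-1},\ \mu_1=\mu_2^{-1}$; (iii) $p_1=p_2,\ q_1=q_2^{-1},\ \lambda_1=\mu_2,\ \lambda_2=\mu_1$; (iv) $p_1=p_2^{-1},\ q_1=q_2^{-1},\ \lambda_1=\mu_2^{-1},\ \lambda_2=\mu_1^{-1}$.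
   Context: For a field $\mathbb{K}$ and $p,q,\lambda,\mu\in\mathbb{K}^{\ast}$, $\mathcal{A}_p(\lambda,\mu,\mathbb{K}_q[s,t])$ denotes the associative unital $\mathbb{K}$-algebra generated by $x,y,s,t$ subject to the relations $$xy-pyx=1,\quad st=qts,\quad sx=\lambda xs,\quad sy=\lambda^{-1}ys,\quad tx=\mu xt,\quad ty=\mu^{-1}yt.$$ For a $\mathbb{K}$-algebra $A$, $A[w]=A\otimes_{\mathbb{K}}\mathbb{K}[w]$ (with $w$ central). The number $1$ counts as a root of unity. *)

theory Defs
  imports "HOL-Algebra.QuotRing" "HOL-Algebra.UnivPoly" "HOL-Library.Poly_Mapping"
begin

section \<open>Associative algebras over a field\<close>

text \<open>
  The ground field is a type \<open>'k\<close> of class \<^class>\<open>field\<close>. An associative unital algebra over it is a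
  record of type \<open>('k, 'a) module\<close>: a (not necessarily commutative) ring with a scalar multiplication
  by all elements of \<open>'k\<close>. The locale \<open>algebra\<close> of the library is only for commutative rings.
\<close>

definition alg_iso ::
    "('k::field, 'a, 'r) module_scheme \<Rightarrow> ('k, 'b, 's) module_scheme \<Rightarrow> ('a \<Rightarrow> 'b) set"
  where "alg_iso A B =
    {h \<in> ring_iso A B. \<forall>c. \<forall>a\<in>carrier A. h (c \<odot>\<^bsub>A\<^esub> a) = c \<odot>\<^bsub>B\<^esub> h a}"

definition alg_isomorphic ::
    "('k::field, 'a, 'r) module_scheme \<Rightarrow> ('k, 'b, 's) module_scheme \<Rightarrow> bool"
  where "alg_isomorphic A B \<longleftrightarrow> alg_iso A B \<noteq> {}"

text \<open>
  The scalar multiplication on cosets is set up in the same way as the product in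
  \<^const>\<open>FactRing\<close>: \<open>c \<odot> (I + x) = I + c \<odot> x\<close>.
\<close>

definition quot_alg :: "('k::field, 'a, 'r) module_scheme \<Rightarrow> 'a set \<Rightarrow> ('k, 'a set) module"
  where "quot_alg A I =
    \<lparr>carrier = carrier (A Quot I), monoid.mult = monoid.mult (A Quot I), one = one (A Quot I),
     zero = zero (A Quot I), add = add (A Quot I),
     smult = (\<lambda>c X. \<Union>x\<in>X. I +>\<^bsub>A\<^esub> (c \<odot>\<^bsub>A\<^esub> x))\<rparr>"

text \<open>
  \<open>A[w]\<close> with \<open>w\<close> central. The ring structure is that of \<^const>\<open>UP\<close>: finitely supported coefficient
  sequences with the Cauchy product, so \<open>w\<close> commutes with the coefficients although \<open>A\<close> need not
  be commutative. The scalars of \<^term>\<open>UP A\<close> itself are the elements of \<open>A\<close>; here they are the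
  elements of \<open>'k\<close>.
\<close>

definition poly_alg :: "('k::field, 'a, 'r) module_scheme \<Rightarrow> ('k, nat \<Rightarrow> 'a) module"
  where "poly_alg A =
    \<lparr>carrier = carrier (UP A), monoid.mult = monoid.mult (UP A), one = one (UP A),
     zero = zero (UP A), add = add (UP A),
     smult = (\<lambda>c f n. c \<odot>\<^bsub>A\<^esub> f n)\<rparr>"


section \<open>Free algebras\<close>

text \<open>
  The free monoid on \<open>'a\<close>, written additively because the convolution product on
  \<^typ>\<open>'a \<Rightarrow>\<^sub>0 'b\<close> expects an additive monoid of exponents.
\<close>

datatype 'a free_monoid = Word (letters: "'a list")

instantiation free_monoid :: (type) monoid_add
begin

definition zero_free_monoid :: "'a free_monoid"
  where "0 = Word []"

definition plus_free_monoid :: "'a free_monoid \<Rightarrow> 'a free_monoid \<Rightarrow> 'a free_monoid"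
  where "u + v = Word (letters u @ letters v)"

instance
  by standard (simp_all add: zero_free_monoid_def plus_free_monoid_def)

end

text \<open>Noncommutative polynomials: finite linear combinations of words.\<close>

type_synonym ('g, 'k) ncpoly = "'g free_monoid \<Rightarrow>\<^sub>0 'k"

definition ncconst :: "'k::field \<Rightarrow> ('g, 'k) ncpoly"
  where "ncconst c = Poly_Mapping.single 0 c"

definition ncvar :: "'g \<Rightarrow> ('g, 'k::field) ncpoly"
  where "ncvar g = Poly_Mapping.single (Word [g]) 1"

definition free_alg :: "('k::field, ('g, 'k) ncpoly) module"
  where "free_alg =
    \<lparr>carrier = UNIV, monoid.mult = (*), one = 1, zero = 0, add = (+),
     smult = (\<lambda>c f. ncconst c * f)\<rparr>"

definition presented_alg :: "('g, 'k::field) ncpoly set \<Rightarrow> ('k, ('g, 'k) ncpoly set) module"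
  where "presented_alg R = quot_alg free_alg (Idl\<^bsub>free_alg\<^esub> R)"


section \<open>The algebras \<open>\<A>\<^sub>p(\<lambda>, \<mu>, \<bbbK>\<^sub>q[s,t])\<close>\<close>

datatype gen = Gen_x | Gen_y | Gen_s | Gen_t

text \<open>Each relation \<open>u = v\<close> is represented by \<open>u - v\<close>.\<close>

definition weyl_relations :: "'k::field \<Rightarrow> 'k \<Rightarrow> 'k \<Rightarrow> 'k \<Rightarrow> (gen, 'k) ncpoly set"
  where "weyl_relations p l m q =
    (let x = ncvar Gen_x; y = ncvar Gen_y; s = ncvar Gen_s; t = ncvar Gen_t in
     {x * y - ncconst p * y * x - 1,
      s * t - ncconst q * t * s,
      s * x - ncconst l * x * s,
      s * y - ncconst (inverse l) * y * s,
      t * x - ncconst m * x * t,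
      t * y - ncconst (inverse m) * y * t})"

text \<open>The arguments are in the order \<open>p, \<lambda>, \<mu>, q\<close> in which they occur in the notation.\<close>

definition weyl_alg :: "'k::field \<Rightarrow> 'k \<Rightarrow> 'k \<Rightarrow> 'k \<Rightarrow> ('k, (gen, 'k) ncpoly set) module"
  where "weyl_alg p l m q = presented_alg (weyl_relations p l m q)"

definition root_of_unity :: "'k::field \<Rightarrow> bool"
  where "root_of_unity a \<longleftrightarrow> (\<exists>n>0. a ^ n = 1)"


section \<open>Well-formedness\<close>

lemma ring_free_alg: "ring free_alg"
proof (intro ringI abelian_groupI monoidI)
  fix x :: "('a, 'b) ncpoly"
  show "\<exists>y\<in>carrier free_alg. y \<oplus>\<^bsub>free_alg\<^esub> x = \<zero>\<^bsub>free_alg\<^esub>"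
    by (rule bexI[of _ "- x"]) (simp_all add: free_alg_def)
qed (simp_all add: free_alg_def add.assoc add.commute add.left_commute mult.assoc distrib_left distrib_right)

lemma ring_same_ops:
  assumes "ring A"
    and ops: "carrier B = carrier A" "monoid.mult B = monoid.mult A" "one B = one A"
      "zero B = zero A" "add B = add A"
  shows "ring B"
proof -
  interpret ring A by fact
  show ?thesis
  proof (intro ringI abelian_groupI monoidI; unfold ops)
    show "\<exists>y\<in>carrier A. y \<oplus>\<^bsub>A\<^esub> x = \<zero>\<^bsub>A\<^esub>" if "x \<in> carrier A" for x
      using that by (intro bexI[of _ "\<ominus>\<^bsub>A\<^esub> x"]) (simp_all add: l_neg)
  qed (simp_all add: a_ac m_assoc l_distr r_distr)
qed

lemma ring_quot_alg: "ideal I A \<Longrightarrow> ring (quot_alg A I)"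
  by (rule ring_same_ops[OF ideal.quotient_is_ring[of I A]]) (simp_all add: quot_alg_def)

lemma ring_poly_alg: "ring A \<Longrightarrow> ring (poly_alg A)"
  by (rule ring_same_ops[OF UP_ring.UP_ring[of A]]) (simp_all add: poly_alg_def UP_ring_def)

lemma ideal_presented_alg: "ideal (Idl\<^bsub>free_alg\<^esub> R) free_alg"
  by (rule ring.genideal_ideal[OF ring_free_alg]) (simp add: free_alg_def)

lemma ring_weyl_alg: "ring (weyl_alg p l m q)"
  by (simp add: weyl_alg_def presented_alg_def ring_quot_alg ideal_presented_alg)

lemma smult_quot_alg:
  assumes "ideal I (free_alg :: ('k::field, ('g, 'k) ncpoly) module)"
  shows "c \<odot>\<^bsub>quot_alg free_alg I\<^esub> (I +>\<^bsub>free_alg\<^esub> f) = I +>\<^bsub>free_alg\<^esub> (c \<odot>\<^bsub>free_alg\<^esub> f)"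
proof -
  let ?F = "free_alg :: ('k, ('g, 'k) ncpoly) module"
  interpret ideal I ?F by fact
  have eq: "I +>\<^bsub>?F\<^esub> (ncconst c * x) = I +>\<^bsub>?F\<^esub> (ncconst c * f)" if x: "x \<in> I +>\<^bsub>?F\<^esub> f" for x
  proof -
    from x obtain i where i: "i \<in> I" and x_eq: "x = i + f"
      by (auto simp: a_r_coset_def r_coset_def free_alg_def)
    have "ncconst c * i \<in> I"
      using I_l_closed[OF i, of "ncconst c"] by (simp add: free_alg_def)
    then have "ncconst c * x \<in> I +>\<^bsub>?F\<^esub> (ncconst c * f)"
      by (auto simp: x_eq a_r_coset_def r_coset_def free_alg_def algebra_simps)
    then show ?thesis
      by (intro a_repr_independence'[symmetric]) (simp_all add: free_alg_def)
  qed
  have "f \<in> I +>\<^bsub>?F\<^esub> f"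
    using a_rcos_self[of f] by (simp add: free_alg_def)
  then have "(\<Union>x\<in>I +>\<^bsub>?F\<^esub> f. I +>\<^bsub>?F\<^esub> (ncconst c * x)) = I +>\<^bsub>?F\<^esub> (ncconst c * f)"
    using eq by blast
  moreover have "c \<odot>\<^bsub>?F\<^esub> x = ncconst c * x" for x
    by (simp add: free_alg_def)
  ultimately show ?thesis
    by (simp add: quot_alg_def)
qed

end

theory Submission
  imports Defs "HOL-Computational_Algebra.Polynomial" "HOL-Library.Product_Lexorder" "HOL-Library.Product_Plus"
begin

text \<open>
  Put \<open>z = xy - yx = 1 + (p - 1)yx\<close>. Then \<open>xz = pzx\<close>, \<open>zy = pyz\<close>, and \<open>z\<close> commutes with \<open>s\<close> and \<open>t\<close>, so that
  \<open>x, z, s, t\<close> commute pairwise up to scalars. After \<open>x\<close> is inverted, \<open>y = (z - 1)x\<^sup>-\<^sup>1 / (p - 1)\<close>. Hence \<open>A[w]\<close>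
  embeds in the twisted group algebra of \<open>\<int>\<^sup>4\<close> over \<open>K[w]\<close> that has the monomials \<open>z\<^sup>d x\<^sup>i s\<^sup>a t\<^sup>b\<close> as a basis
  (\<open>inj_on_embed\<close>). The embedding is injective because the monomials \<open>y\<^sup>j x\<^sup>i s\<^sup>a t\<^sup>b\<close> span \<open>A\<close> (\<open>spanned_all\<close>) and
  have images with different leading terms (\<open>val_comb_nonzero\<close>). In the twisted group algebra everything can be
  read off from supports.

  The invariant that recovers the parameters is the monoid of normal elements, those \<open>u\<close> for which every
  \<open>uv\<close> is some \<open>v'u\<close>. If \<open>ug = vu\<close> for a monomial \<open>g\<close>, then comparison of the largest and of the smallest exponents
  shows that \<open>v\<close> is a multiple of \<open>g\<close>. So all exponents of \<open>u\<close> have the same commutation factors with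
  \<open>x, z, s, t\<close>, and since \<open>p\<close> and \<open>q\<close> are not roots of unity, they coincide. The generator \<open>y\<close>, which is not a
  monomial, forces the exponent of \<open>x\<close> to vanish. Thus normal elements have the form \<open>f(w) z\<^sup>d s\<^sup>a t\<^sup>b\<close>
  (\<open>normal_single\<close>), and the central ones among them lie in \<open>K[w]\<close> (\<open>normal_central_scalar\<close>).

  An isomorphism \<open>\<psi>\<close> maps normal elements to normal elements and central ones to central ones. The exponents of
  \<open>\<psi>(z), \<psi>(s), \<psi>(t)\<close> form a matrix of natural numbers, and \<open>\<psi>\<^sup>-\<^sup>1\<close> provides an inverse of the same kind, so it is a
  permutation matrix. Since \<open>s\<close> and \<open>t\<close> do not commute but \<open>z\<close> commutes with both, \<open>z\<close> corresponds to \<open>z\<close>, and \<open>s, t\<close>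
  are fixed or exchanged (\<open>psi_degrees\<close>); this relates \<open>q\<^sub>1\<close> to \<open>q\<^sub>2\<close>. Commutation with \<open>z\<close> shows that
  \<open>\<psi>(x)\<close> and \<open>\<psi>(y)\<close> are homogeneous of opposite \<open>x\<close>-degrees \<open>i\<close> and \<open>- i\<close> with \<open>p\<^sub>1 = p\<^sub>2\<^sup>i\<close>; by symmetry \<open>p\<^sub>2\<close>
  is a power of \<open>p\<^sub>1\<close>, whence \<open>i = \<plusminus>1\<close>. Commutation with \<open>s\<close> and \<open>t\<close> gives \<open>\<lambda>\<^sub>1\<close> and \<open>\<mu>\<^sub>1\<close> up to powers of \<open>q\<^sub>2\<close>
  whose exponents are nonnegative both for \<open>\<psi>(x)\<close> and for \<open>\<psi>(y)\<close> and add up to zero (\<open>scaling_relation\<close>).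

  Conversely, exchanging \<open>x\<close> with a multiple of \<open>y\<close>, or \<open>s\<close> with \<open>t\<close>, is an automorphism of the free algebra that
  carries the relations of one parameter set to those of another (\<open>weyl_alg_exchange_xy\<close>,
  \<open>weyl_alg_exchange_st\<close>).
\<close>

section \<open>Additive extension and evaluation of noncommutative polynomials\<close>

abbreviation "lookup \<equiv> Poly_Mapping.lookup"
abbreviation "keys \<equiv> Poly_Mapping.keys"
abbreviation "single \<equiv> Poly_Mapping.single"

lemma poly_mapping_additive_induct [case_names single add]:
  assumes mono: "\<And>n a. P (single n a)"
    and add: "\<And>f g. P f \<Longrightarrow> P g \<Longrightarrow> P (f + g)"
  shows "P (f :: 'n \<Rightarrow>\<^sub>0 'k::comm_monoid_add)"
proof (induction f rule: update_induct)
  case const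
  then show ?case using mono[of undefined 0] by simp
next
  case (update f a b)
  have "Poly_Mapping.update a b f = f + single a b"
    using update.hyps(1) by (intro poly_mapping_eqI)
      (auto simp: lookup_update lookup_add lookup_single when_def in_keys_iff)
  then show ?case using add update mono by simp
qed

lemma single_eq_zero_iff: "single n r = 0 \<longleftrightarrow> r = 0"
  by (metis lookup_single_eq lookup_zero single_zero)

lemma poly_mapping_sum_singles: "(\<Sum>a\<in>keys u. single a (lookup u a)) = u"
  by (rule poly_mapping_eqI)
    (simp add: lookup_sum lookup_single when_def in_keys_iff)

text \<open>Evaluation of noncommutative polynomials, linear combinations of ordered monomials, linear functionals and
  twisted products are all instances of this extension.\<close>

definition additive_ext :: "('n \<Rightarrow> 'k::comm_monoid_add \<Rightarrow> 'r::ab_group_add) \<Rightarrow> ('n \<Rightarrow>\<^sub>0 'k) \<Rightarrow> 'r"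
  where "additive_ext h f = (\<Sum>n\<in>keys f. h n (lookup f n))"

context
  fixes h :: "'n \<Rightarrow> 'k::comm_monoid_add \<Rightarrow> 'r::ab_group_add"
  assumes h_add: "\<And>n a b. h n (a + b) = h n a + h n b"
begin

lemma additive_zero: "h n 0 = 0"
  using h_add[of n 0 0] by simp

lemma additive_ext_superset:
  assumes "finite S" "keys f \<subseteq> S"
  shows "additive_ext h f = (\<Sum>n\<in>S. h n (lookup f n))"
  unfolding additive_ext_def using assms
  by (intro sum.mono_neutral_left) (auto simp: in_keys_iff additive_zero)

lemma additive_ext_single: "additive_ext h (single n a) = h n a"
  by (simp add: additive_ext_def additive_zero)

lemma additive_ext_add: "additive_ext h (f + g) = additive_ext h f + additive_ext h g"
proof -
  let ?S = "keys f \<union> keys g"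
  have "additive_ext h (f + g) = (\<Sum>n\<in>?S. h n (lookup (f + g) n))"
    by (rule additive_ext_superset) (use keys_add[of f g] in auto)
  also have "\<dots> = (\<Sum>n\<in>?S. h n (lookup f n)) + (\<Sum>n\<in>?S. h n (lookup g n))"
    by (simp add: lookup_add h_add sum.distrib)
  also have "\<dots> = additive_ext h f + additive_ext h g"
    by (simp add: additive_ext_superset[of ?S])
  finally show ?thesis .
qed

end

text \<open>An associative unital algebra whose carrier is a whole type, with the product as an explicit function. The same
  notion then covers the free algebra and twisted group algebras, whose product depends on parameters
  and is therefore no type class operation.\<close>

locale type_algebra =
  fixes mul :: "'r::ab_group_add \<Rightarrow> 'r \<Rightarrow> 'r" and unit :: 'r and scale :: "'k::field \<Rightarrow> 'r \<Rightarrow> 'r"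
  assumes mul_assoc: "mul (mul u v) w = mul u (mul v w)"
    and mul_add_left: "mul (u + v) w = mul u w + mul v w"
    and mul_add_right: "mul w (u + v) = mul w u + mul w v"
    and mul_unit_left: "mul unit u = u"
    and mul_unit_right: "mul u unit = u"
    and scale_add_left: "scale (a + b) u = scale a u + scale b u"
    and scale_add_right: "scale a (u + v) = scale a u + scale a v"
    and scale_scale: "scale a (scale b u) = scale (a * b) u"
    and scale_one: "scale 1 u = u"
    and mul_scale_left: "mul (scale a u) v = scale a (mul u v)"
    and mul_scale_right: "mul u (scale a v) = scale a (mul u v)"
begin

definition word_val :: "('g \<Rightarrow> 'r) \<Rightarrow> 'g free_monoid \<Rightarrow> 'r"
  where "word_val g w = foldr (\<lambda>x. mul (g x)) (letters w) unit"

definition ev :: "('g \<Rightarrow> 'r) \<Rightarrow> ('g, 'k) ncpoly \<Rightarrow> 'r"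
  where "ev g = additive_ext (\<lambda>w c. scale c (word_val g w))"

lemma word_val_append: "word_val g (u + v) = mul (word_val g u) (word_val g v)"
proof -
  have "foldr (\<lambda>x. mul (g x)) (us @ vs) unit
      = mul (foldr (\<lambda>x. mul (g x)) us unit) (foldr (\<lambda>x. mul (g x)) vs unit)" for us vs
    by (induction us) (simp_all add: mul_unit_left mul_assoc)
  then show ?thesis by (simp add: word_val_def plus_free_monoid_def)
qed

lemma ev_add: "ev g (f + f') = ev g f + ev g f'"
  unfolding ev_def by (rule additive_ext_add) (rule scale_add_left)

lemma ev_single: "ev g (single w c) = scale c (word_val g w)"
  unfolding ev_def by (rule additive_ext_single) (rule scale_add_left)

lemma ev_zero: "ev g 0 = 0"
  using ev_add[of g 0 0] by simp

lemma ev_uminus: "ev g (- f) = - ev g f"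
  using ev_add[of g f "- f"] by (simp add: ev_zero minus_unique)

lemma ev_diff: "ev g (f - f') = ev g f - ev g f'"
  using ev_add[of g f "- f'"] by (simp add: ev_uminus)

lemma ev_mult: "ev g (f * f') = mul (ev g f) (ev g f')"
proof (induction f rule: poly_mapping_additive_induct)
  case (single u a)
  show ?case
  proof (induction f' rule: poly_mapping_additive_induct)
    case (single v b)
    show ?case
      by (simp add: mult_single ev_single word_val_append mul_scale_left mul_scale_right
          scale_scale mult.commute)
  qed (simp add: distrib_left ev_add mul_add_right)
qed (simp add: distrib_right ev_add mul_add_left)

lemma ev_ncconst: "ev g (ncconst c) = scale c unit"
  by (simp add: ncconst_def ev_single word_val_def zero_free_monoid_def)

lemma ev_one: "ev g 1 = unit"
  using ev_ncconst[of g 1] by (simp add: ncconst_def scale_one)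

lemma ev_ncvar: "ev g (ncvar x) = g x"
  by (simp add: ncvar_def ev_single word_val_def mul_unit_right scale_one)

lemma ev_scaled: "ev g (ncconst c * f) = scale c (ev g f)"
  by (simp add: ev_mult ev_ncconst mul_scale_left mul_unit_left)

lemmas ev_simps = ev_add ev_diff ev_uminus ev_mult ev_zero ev_one ev_ncvar

end

lemma ncconst_add: "ncconst (a + b) = ncconst a + ncconst b"
  by (simp add: ncconst_def single_add)

lemma ncconst_mult: "ncconst (a * b) = ncconst a * ncconst b"
  by (simp add: ncconst_def mult_single)

lemma ncconst_one [simp]: "ncconst 1 = 1"
  by (simp add: ncconst_def)

lemma ncconst_central: "f * ncconst c = ncconst c * f"
  by (induction f rule: poly_mapping_additive_induct)
    (simp_all add: ncconst_def mult_single mult.commute distrib_left distrib_right)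

lemma ncconst_left_commute: "f * (ncconst c * g) = ncconst c * (f * g)"
  by (metis ncconst_central mult.assoc)

text \<open>Evaluation in the free algebra itself is substitution.\<close>

interpretation nc: type_algebra "(*)" "1 :: ('g, 'k::field) ncpoly" "\<lambda>c f. ncconst c * f"
proof
  show "f * (ncconst c * g) = ncconst c * (f * g)" for c and f g :: "('g, 'k) ncpoly"
    by (rule ncconst_left_commute)
qed (simp_all add: ncconst_add ncconst_mult algebra_simps)

text \<open>A noncommutative polynomial is a polynomial in words, so an induction over it may build words
  letter by letter from the left.\<close>

lemma ncpoly_induct [case_names const add var]:
  assumes const: "\<And>c. P (ncconst c)"
    and add: "\<And>f g. P f \<Longrightarrow> P g \<Longrightarrow> P (f + g)"
    and var: "\<And>x f. P f \<Longrightarrow> P (ncvar x * f)"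
  shows "P f"
proof (induction f rule: poly_mapping_additive_induct)
  case (single w c)
  have "P (single (Word xs) c)" for xs
  proof (induction xs)
    case Nil
    show ?case using const[of c] by (simp add: ncconst_def zero_free_monoid_def)
  next
    case (Cons x xs)
    then show ?case using var[of _ x]
      by (fastforce simp: ncvar_def mult_single plus_free_monoid_def)
  qed
  then show ?case by (cases w) auto
qed (rule add)


section \<open>Quotients of the free algebra and their isomorphisms\<close>

lemma ideal_free_algI:
  fixes J :: "('g, 'k::field) ncpoly set"
  assumes "0 \<in> J" "\<And>f g. f \<in> J \<Longrightarrow> g \<in> J \<Longrightarrow> f + g \<in> J" "\<And>f. f \<in> J \<Longrightarrow> - f \<in> J"
    "\<And>f g. f \<in> J \<Longrightarrow> g * f \<in> J" "\<And>f g. f \<in> J \<Longrightarrow> f * g \<in> J"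
  shows "ideal J free_alg"
proof (rule idealI[OF ring_free_alg])
  have inv: "inv\<^bsub>add_monoid free_alg\<^esub> f = - f" for f :: "('g, 'k) ncpoly"
  proof -
    interpret F: ring "free_alg :: ('k, ('g, 'k) ncpoly) module" by (rule ring_free_alg)
    show ?thesis
      using F.minus_equality[of "- f" f] by (simp add: a_inv_def free_alg_def)
  qed
  show "subgroup J (add_monoid free_alg)"
    by standard (auto simp: assms inv, auto simp: free_alg_def assms)
qed (simp_all add: assms free_alg_def)

lemma ideal_free_algD:
  assumes "ideal J (free_alg :: ('k::field, ('g, 'k) ncpoly) module)"
  shows "0 \<in> J" "f \<in> J \<Longrightarrow> g \<in> J \<Longrightarrow> f + g \<in> J" "f \<in> J \<Longrightarrow> - f \<in> J"
    "f \<in> J \<Longrightarrow> g * f \<in> J" "f \<in> J \<Longrightarrow> f * g \<in> J"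
proof -
  let ?F = "free_alg :: ('k, ('g, 'k) ncpoly) module"
  interpret ideal J ?F by fact
  show "0 \<in> J" using additive_subgroup.zero_closed[OF is_additive_subgroup] by (simp add: free_alg_def)
  show "f \<in> J \<Longrightarrow> g \<in> J \<Longrightarrow> f + g \<in> J"
    using additive_subgroup.a_closed[OF is_additive_subgroup, of f g] by (simp add: free_alg_def)
  show l: "f \<in> J \<Longrightarrow> g * f \<in> J" for f g using I_l_closed[of f g] by (simp add: free_alg_def)
  show "f \<in> J \<Longrightarrow> f * g \<in> J" using I_r_closed[of f g] by (simp add: free_alg_def)
  show "f \<in> J \<Longrightarrow> - f \<in> J" using l[of f "- 1"] by simp
qed

abbreviation nc_ideal :: "('g, 'k::field) ncpoly set \<Rightarrow> ('g, 'k) ncpoly set"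
  where "nc_ideal R \<equiv> Idl\<^bsub>free_alg\<^esub> R"

lemma nc_ideal_minimal:
  assumes "ideal J free_alg" "R \<subseteq> J"
  shows "nc_ideal R \<subseteq> J"
  using ring.genideal_minimal[OF ring_free_alg assms] .

lemma nc_ideal_superset: "R \<subseteq> nc_ideal R"
  by (rule ring.genideal_self[OF ring_free_alg]) (simp add: free_alg_def)

definition nc_coset :: "('g, 'k::field) ncpoly set \<Rightarrow> ('g, 'k) ncpoly \<Rightarrow> ('g, 'k) ncpoly set"
  where "nc_coset I f = {g. g - f \<in> I}"

lemma a_r_coset_free_alg: "I +>\<^bsub>free_alg\<^esub> f = nc_coset I f"
  by (auto simp: a_r_coset_def r_coset_def free_alg_def nc_coset_def)

lemma nc_coset_eq_iff:
  assumes "ideal I free_alg"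
  shows "nc_coset I f = nc_coset I g \<longleftrightarrow> f - g \<in> I"
proof -
  note I = ideal_free_algD[OF assms]
  have eq: "nc_coset I f = nc_coset I g" if "f - g \<in> I"
    unfolding nc_coset_def
  proof (intro Collect_cong iffI)
    show "h - g \<in> I" if "h - f \<in> I" for h
      using I(2)[OF that \<open>f - g \<in> I\<close>] by (simp add: algebra_simps)
    show "h - f \<in> I" if "h - g \<in> I" for h
      using I(2)[OF that I(3)[OF \<open>f - g \<in> I\<close>]] by (simp add: algebra_simps)
  qed
  moreover have "f \<in> nc_coset I f" by (simp add: nc_coset_def I(1))
  moreover have "f - g \<in> I" if "f \<in> nc_coset I g" using that by (simp add: nc_coset_def)
  ultimately show ?thesis by metis
qed

context
  fixes I :: "('g, 'k::field) ncpoly set"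
  assumes I: "ideal I free_alg"
begin

interpretation ideal I "free_alg :: ('k, ('g, 'k) ncpoly) module" by (rule I)

lemma quot_carrier: "carrier (quot_alg free_alg I) = range (nc_coset I)"
  by (auto simp: quot_alg_def FactRing_simps a_r_coset_free_alg) (auto simp: free_alg_def)

lemma quot_one: "\<one>\<^bsub>quot_alg free_alg I\<^esub> = nc_coset I 1"
  by (simp add: quot_alg_def FactRing_def a_r_coset_free_alg) (simp add: free_alg_def)

lemma quot_zero: "\<zero>\<^bsub>quot_alg free_alg I\<^esub> = nc_coset I 0"
  by (simp add: quot_alg_def FactRing_def nc_coset_def)

lemma quot_add: "nc_coset I f \<oplus>\<^bsub>quot_alg free_alg I\<^esub> nc_coset I g = nc_coset I (f + g)"
  using a_rcos_sum[of f g] by (simp add: quot_alg_def FactRing_def a_r_coset_free_alg)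
    (simp add: free_alg_def)

lemma quot_mult: "nc_coset I f \<otimes>\<^bsub>quot_alg free_alg I\<^esub> nc_coset I g = nc_coset I (f * g)"
  using rcoset_mult_add[of f g] by (simp add: quot_alg_def FactRing_def a_r_coset_free_alg)
    (simp add: free_alg_def)

lemma quot_smult: "c \<odot>\<^bsub>quot_alg free_alg I\<^esub> nc_coset I f = nc_coset I (ncconst c * f)"
  using smult_quot_alg[OF I, of c f] by (simp add: a_r_coset_free_alg) (simp add: free_alg_def)

end

text \<open>A bijective substitution that matches the two ideals maps cosets onto cosets, so the isomorphism of the quotients
  is the image map.\<close>

lemma alg_isomorphic_quotI:
  fixes \<sigma> :: "('g, 'k::field) ncpoly \<Rightarrow> ('g, 'k) ncpoly"
  assumes I: "ideal I free_alg" and J: "ideal J free_alg"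
    and add: "\<And>f g. \<sigma> (f + g) = \<sigma> f + \<sigma> g" and mult: "\<And>f g. \<sigma> (f * g) = \<sigma> f * \<sigma> g"
    and const: "\<And>c. \<sigma> (ncconst c) = ncconst c"
    and inverse: "\<And>f. \<sigma> (\<tau> f) = f" "\<And>f. \<tau> (\<sigma> f) = f"
    and IJ: "\<And>f. f \<in> I \<Longrightarrow> \<sigma> f \<in> J" and JI: "\<And>f. f \<in> J \<Longrightarrow> \<tau> f \<in> I"
  shows "alg_isomorphic (quot_alg free_alg I) (quot_alg free_alg J)"
proof -
  have diff: "\<sigma> (f - g) = \<sigma> f - \<sigma> g" for f g
    using add[of "f - g" g] by (simp add: eq_diff_eq)
  have mem: "\<sigma> f \<in> J \<longleftrightarrow> f \<in> I" for f using IJ[of f] JI[of "\<sigma> f"] inverse(2)[of f] by auto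
  have inj: "inj \<sigma>" by (rule inj_on_inverseI) (rule inverse(2))
  have coset: "\<sigma> ` nc_coset I f = nc_coset J (\<sigma> f)" for f
  proof
    show "\<sigma> ` nc_coset I f \<subseteq> nc_coset J (\<sigma> f)"
      using IJ by (auto simp: nc_coset_def diff[symmetric])
    show "nc_coset J (\<sigma> f) \<subseteq> \<sigma> ` nc_coset I f"
    proof
      fix g assume "g \<in> nc_coset J (\<sigma> f)"
      then have "\<sigma> (\<tau> g - f) \<in> J" by (simp add: nc_coset_def diff inverse)
      then show "g \<in> \<sigma> ` nc_coset I f"
        by (intro image_eqI[of _ _ "\<tau> g"]) (simp_all add: mem nc_coset_def inverse)
    qed
  qed
  have one: "\<sigma> 1 = 1" using const[of 1] by simp
  have "(`) \<sigma> \<in> ring_iso (quot_alg free_alg I) (quot_alg free_alg J)"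
  proof (rule ring_iso_memI)
    show "bij_betw ((`) \<sigma>) (carrier (quot_alg free_alg I)) (carrier (quot_alg free_alg J))"
    proof (rule bij_betwI')
      fix X Y assume "X \<in> carrier (quot_alg free_alg I)" "Y \<in> carrier (quot_alg free_alg I)"
      show "(\<sigma> ` X = \<sigma> ` Y) = (X = Y)"
        by (rule inj_image_eq_iff[OF inj])
    next
      fix Y assume "Y \<in> carrier (quot_alg free_alg J)"
      then obtain g where "Y = nc_coset J g" by (auto simp: quot_carrier J)
      then have "Y = \<sigma> ` nc_coset I (\<tau> g)" by (simp add: coset inverse)
      then show "\<exists>X\<in>carrier (quot_alg free_alg I). Y = \<sigma> ` X" by (auto simp: quot_carrier I)
    qed (auto simp: quot_carrier I J coset)
  next
    fix X Y assume "X \<in> carrier (quot_alg free_alg I)" "Y \<in> carrier (quot_alg free_alg I)"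
    then obtain f g where [simp]: "X = nc_coset I f" "Y = nc_coset I g"
      by (auto simp: quot_carrier I)
    show "\<sigma> ` (X \<otimes>\<^bsub>quot_alg free_alg I\<^esub> Y) = \<sigma> ` X \<otimes>\<^bsub>quot_alg free_alg J\<^esub> \<sigma> ` Y"
      by (simp add: quot_mult I J coset mult)
    show "\<sigma> ` (X \<oplus>\<^bsub>quot_alg free_alg I\<^esub> Y) = \<sigma> ` X \<oplus>\<^bsub>quot_alg free_alg J\<^esub> \<sigma> ` Y"
      by (simp add: quot_add I J coset add)
  qed (auto simp: quot_carrier quot_one I J coset one)
  moreover have "\<sigma> ` (c \<odot>\<^bsub>quot_alg free_alg I\<^esub> X) = c \<odot>\<^bsub>quot_alg free_alg J\<^esub> (\<sigma> ` X)"
    if X: "X \<in> carrier (quot_alg free_alg I)" for c X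
  proof -
    obtain f where [simp]: "X = nc_coset I f" using X by (auto simp: quot_carrier I)
    show ?thesis by (simp add: quot_smult I J coset mult const)
  qed
  ultimately show ?thesis unfolding alg_isomorphic_def alg_iso_def by blast
qed

lemma alg_isomorphic_poly_alg:
  fixes A :: "('k::field, 'a) module" and B :: "('k, 'b) module"
  assumes A: "ring A" and B: "ring B" and AB: "alg_isomorphic A B"
  shows "alg_isomorphic (poly_alg A) (poly_alg B)"
proof -
  obtain h where h: "h \<in> ring_iso A B" and smult: "\<And>c a. a \<in> carrier A \<Longrightarrow> h (c \<odot>\<^bsub>A\<^esub> a) = c \<odot>\<^bsub>B\<^esub> h a"
    using AB by (auto simp: alg_isomorphic_def alg_iso_def)
  note hD = ring_iso_memE[OF h]
  interpret ring_hom_ring A B h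
    by (intro ring_hom_ringI2 A B) (use h in \<open>simp add: ring_iso_def\<close>)
  define g where "g = inv_into (carrier A) h"
  have g: "b \<in> carrier B \<Longrightarrow> g b \<in> carrier A" "b \<in> carrier B \<Longrightarrow> h (g b) = b" for b
    using hD(5) by (auto simp: g_def bij_betw_def inv_into_into f_inv_into_f)
  have inj: "a \<in> carrier A \<Longrightarrow> b \<in> carrier A \<Longrightarrow> h a = h b \<longleftrightarrow> a = b" for a b
    using hD(5) by (auto simp: bij_betw_def inj_on_def)
  have up: "(\<lambda>n. h (f n)) \<in> up B" if f: "f \<in> up A" for f
  proof
    from f obtain n where "bound \<zero>\<^bsub>A\<^esub> n f" by (auto simp: up_def)
    then have "bound \<zero>\<^bsub>B\<^esub> n (\<lambda>n. h (f n))" by (auto simp: bound_def)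
    then show "\<exists>n. bound \<zero>\<^bsub>B\<^esub> n (\<lambda>n. h (f n))" ..
  qed (simp add: mem_upD[OF f])
  have g0: "g \<zero>\<^bsub>B\<^esub> = \<zero>\<^bsub>A\<^esub>" using inj[of "g \<zero>\<^bsub>B\<^esub>" "\<zero>\<^bsub>A\<^esub>"] g by simp
  have up': "(\<lambda>n. g (f n)) \<in> up A" if f: "f \<in> up B" for f
  proof
    from f obtain n where "bound \<zero>\<^bsub>B\<^esub> n f" by (auto simp: up_def)
    then have "bound \<zero>\<^bsub>A\<^esub> n (\<lambda>n. g (f n))" by (auto simp: bound_def g0)
    then show "\<exists>n. bound \<zero>\<^bsub>A\<^esub> n (\<lambda>n. g (f n))" ..
  qed (simp add: mem_upD[OF f] g)
  have "(\<lambda>f n. h (f n)) \<in> ring_iso (poly_alg A) (poly_alg B)"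
  proof (rule ring_iso_memI)
    show "bij_betw (\<lambda>f n. h (f n)) (carrier (poly_alg A)) (carrier (poly_alg B))"
    proof (rule bij_betwI')
      fix f f' assume "f \<in> carrier (poly_alg A)" "f' \<in> carrier (poly_alg A)"
      then have "f n \<in> carrier A" "f' n \<in> carrier A" for n by (auto simp: poly_alg_def UP_def)
      then show "((\<lambda>n. h (f n)) = (\<lambda>n. h (f' n))) = (f = f')"
        by (auto simp: fun_eq_iff inj)
    next
      fix f assume "f \<in> carrier (poly_alg B)"
      then show "\<exists>f'\<in>carrier (poly_alg A). f = (\<lambda>n. h (f' n))"
        by (intro bexI[of _ "\<lambda>n. g (f n)"]) (auto simp: poly_alg_def UP_def up' g mem_upD)
    qed (auto simp: poly_alg_def UP_def up)
  next
    fix f f' assume ff': "f \<in> carrier (poly_alg A)" "f' \<in> carrier (poly_alg A)"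
    then have c: "f n \<in> carrier A" "f' n \<in> carrier A" for n by (auto simp: poly_alg_def UP_def)
    show "(\<lambda>n. h ((f \<otimes>\<^bsub>poly_alg A\<^esub> f') n)) = (\<lambda>n. h (f n)) \<otimes>\<^bsub>poly_alg B\<^esub> (\<lambda>n. h (f' n))"
      using ff' by (auto simp: poly_alg_def UP_def up c hom_finsum Pi_def o_def mem_upD intro!: ext)
    show "(\<lambda>n. h ((f \<oplus>\<^bsub>poly_alg A\<^esub> f') n)) = (\<lambda>n. h (f n)) \<oplus>\<^bsub>poly_alg B\<^esub> (\<lambda>n. h (f' n))"
      using ff' by (auto simp: poly_alg_def UP_def up c)
  qed (auto simp: poly_alg_def UP_def up)
  moreover have "(\<lambda>n. h ((c \<odot>\<^bsub>poly_alg A\<^esub> f) n)) = c \<odot>\<^bsub>poly_alg B\<^esub> (\<lambda>n. h (f n))"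
    if "f \<in> carrier (poly_alg A)" for c f
    using that by (auto simp: poly_alg_def UP_def smult mem_upD)
  ultimately show ?thesis
    unfolding alg_isomorphic_def alg_iso_def by blast
qed

lemma alg_isomorphic_refl: "alg_isomorphic A A"
proof -
  have "id \<in> alg_iso A A" by (simp add: alg_iso_def ring_iso_set_refl)
  then show ?thesis by (auto simp: alg_isomorphic_def)
qed

lemma alg_isomorphic_trans:
  assumes "alg_isomorphic A B" "alg_isomorphic B C"
  shows "alg_isomorphic A C"
proof -
  obtain f g where f: "f \<in> ring_iso A B" "\<And>c a. a \<in> carrier A \<Longrightarrow> f (c \<odot>\<^bsub>A\<^esub> a) = c \<odot>\<^bsub>B\<^esub> f a"
    and g: "g \<in> ring_iso B C" "\<And>c b. b \<in> carrier B \<Longrightarrow> g (c \<odot>\<^bsub>B\<^esub> b) = c \<odot>\<^bsub>C\<^esub> g b"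
    using assms unfolding alg_isomorphic_def alg_iso_def by blast
  have "g \<circ> f \<in> alg_iso A C"
    using ring_iso_set_trans[OF f(1) g(1)] ring_iso_memE(1)[OF f(1)] f(2) g(2)
    by (simp add: alg_iso_def)
  then show ?thesis by (auto simp: alg_isomorphic_def)
qed

text \<open>It suffices to check the relations, because the preimage of an ideal under a substitution is an ideal.\<close>

lemma alg_isomorphic_presented_alg:
  fixes R R' :: "('g, 'k::field) ncpoly set"
  assumes inverse: "\<And>x. nc.ev g (h x) = ncvar x" "\<And>x. nc.ev h (g x) = ncvar x"
    and R: "\<And>r. r \<in> R \<Longrightarrow> nc.ev g r \<in> nc_ideal R'" and R': "\<And>r. r \<in> R' \<Longrightarrow> nc.ev h r \<in> nc_ideal R"
  shows "alg_isomorphic (presented_alg R) (presented_alg R')"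
proof -
  have preimage: "ideal {f. nc.ev u f \<in> nc_ideal S} free_alg"
    for u :: "'g \<Rightarrow> ('g, 'k) ncpoly" and S
    using ideal_free_algD[OF ideal_presented_alg[of S]]
    by (intro ideal_free_algI) (simp_all add: nc.ev_simps)
  have comp: "nc.ev u (nc.ev v f) = f" if "\<And>x. nc.ev u (v x) = ncvar x"
    for u v :: "'g \<Rightarrow> ('g, 'k) ncpoly" and f
    by (induction f rule: ncpoly_induct) (simp_all add: nc.ev_simps nc.ev_ncconst that)
  show ?thesis
    unfolding presented_alg_def
  proof (rule alg_isomorphic_quotI[where \<sigma> = "nc.ev g" and \<tau> = "nc.ev h"])
    show "nc.ev g f \<in> nc_ideal R'" if "f \<in> nc_ideal R" for f
      using nc_ideal_minimal[OF preimage, of R g R'] R that by auto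
    show "nc.ev h f \<in> nc_ideal R" if "f \<in> nc_ideal R'" for f
      using nc_ideal_minimal[OF preimage, of R' h R] R' that by auto
  qed (simp_all add: ideal_presented_alg nc.ev_simps nc.ev_ncconst comp inverse)
qed

lemma nc_ideal_scaled: "r \<in> R \<Longrightarrow> f = ncconst c * r \<Longrightarrow> f \<in> nc_ideal R"
  using ideal_free_algD(4)[OF ideal_presented_alg] nc_ideal_superset by blast

lemma ncvar_ncconst: "ncvar x * ncconst c = ncconst c * ncvar x"
  "ncvar x * (ncconst c * f) = ncconst c * (ncvar x * f)"
  by (rule ncconst_central, rule ncconst_left_commute)

lemma ncconst_ncconst: "ncconst a * (ncconst b * f) = ncconst (a * b) * f"
  by (simp add: ncconst_mult mult.assoc)

lemma ncconst_uminus: "ncconst (- a) = - ncconst a"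
  by (simp add: ncconst_def single_uminus)

text \<open>Identities between the relations follow once all scalars have been moved to the left and collected.\<close>

lemmas nc_normalize = mult.assoc ncvar_ncconst ncconst_ncconst ncconst_mult[symmetric] ncconst_uminus
  right_diff_distrib left_diff_distrib nc.ev_simps nc.ev_ncconst

lemma weyl_relations_mem:
  "ncvar Gen_x * ncvar Gen_y - ncconst p * ncvar Gen_y * ncvar Gen_x - 1 \<in> weyl_relations p l m q"
  "ncvar Gen_s * ncvar Gen_t - ncconst q * ncvar Gen_t * ncvar Gen_s \<in> weyl_relations p l m q"
  "ncvar Gen_s * ncvar Gen_x - ncconst l * ncvar Gen_x * ncvar Gen_s \<in> weyl_relations p l m q"
  "ncvar Gen_s * ncvar Gen_y - ncconst (inverse l) * ncvar Gen_y * ncvar Gen_s \<in> weyl_relations p l m q"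
  "ncvar Gen_t * ncvar Gen_x - ncconst m * ncvar Gen_x * ncvar Gen_t \<in> weyl_relations p l m q"
  "ncvar Gen_t * ncvar Gen_y - ncconst (inverse m) * ncvar Gen_y * ncvar Gen_t \<in> weyl_relations p l m q"
  by (simp_all add: weyl_relations_def Let_def)

lemmas nc_ideal_weyl = weyl_relations_mem[THEN nc_ideal_scaled]

section \<open>The isomorphisms that exchange generators\<close>

text \<open>
  Substituting \<open>x \<mapsto> - p\<^sup>-\<^sup>1 y\<close> and \<open>y \<mapsto> x\<close> turns \<open>xy - pyx - 1\<close> into \<open>xy - p\<^sup>-\<^sup>1 yx - 1\<close>; the factor \<open>- p\<^sup>-\<^sup>1\<close> is what
  restores the constant term.
\<close>

lemma weyl_alg_exchange_xy:
  fixes p l m q :: "'k::field"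
  assumes "p \<noteq> 0"
  shows "alg_isomorphic (weyl_alg p l m q) (weyl_alg (inverse p) (inverse l) (inverse m) q)"
  unfolding weyl_alg_def
proof (rule alg_isomorphic_presented_alg)
  let ?g = "\<lambda>v. case v of Gen_x \<Rightarrow> ncconst (- inverse p) * ncvar Gen_y | Gen_y \<Rightarrow> ncvar Gen_x | v \<Rightarrow> ncvar v"
  let ?h = "\<lambda>v. case v of Gen_x \<Rightarrow> ncvar Gen_y | Gen_y \<Rightarrow> ncconst (- p) * ncvar Gen_x | v \<Rightarrow> ncvar v"
  let ?R = "weyl_relations p l m q" and ?S = "weyl_relations (inverse p) (inverse l) (inverse m) q"
  show "nc.ev ?g (?h v) = ncvar v" "nc.ev ?h (?g v) = ncvar v" for v
    using assms by (cases v; simp add: nc_normalize)+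
  show "nc.ev ?g r \<in> nc_ideal ?S" if "r \<in> ?R" for r
    using that assms unfolding weyl_relations_def[of p l m q] Let_def
    apply (elim insertE emptyE; hypsubst)
    subgoal by (rule nc_ideal_weyl(1)[where c = 1]) (simp add: nc_normalize)
    subgoal by (rule nc_ideal_weyl(2)[where c = 1]) (simp add: nc_normalize)
    subgoal by (rule nc_ideal_weyl(4)[where c = "- inverse p"]) (simp add: nc_normalize mult.commute)
    subgoal by (rule nc_ideal_weyl(3)[where c = 1]) (simp add: nc_normalize)
    subgoal by (rule nc_ideal_weyl(6)[where c = "- inverse p"]) (simp add: nc_normalize mult.commute)
    subgoal by (rule nc_ideal_weyl(5)[where c = 1]) (simp add: nc_normalize)
    done
  show "nc.ev ?h r \<in> nc_ideal ?R" if "r \<in> ?S" for r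
    using that assms unfolding weyl_relations_def[of "inverse p"] Let_def
    apply (elim insertE emptyE; hypsubst)
    subgoal by (rule nc_ideal_weyl(1)[where c = 1]) (simp add: nc_normalize)
    subgoal by (rule nc_ideal_weyl(2)[where c = 1]) (simp add: nc_normalize)
    subgoal by (rule nc_ideal_weyl(4)[where c = 1]) (simp add: nc_normalize)
    subgoal by (rule nc_ideal_weyl(3)[where c = "- p"]) (simp add: nc_normalize mult.commute)
    subgoal by (rule nc_ideal_weyl(6)[where c = 1]) (simp add: nc_normalize)
    subgoal by (rule nc_ideal_weyl(5)[where c = "- p"]) (simp add: nc_normalize mult.commute)
    done
qed

lemma weyl_alg_exchange_st:
  fixes p l m q :: "'k::field"
  assumes "q \<noteq> 0"
  shows "alg_isomorphic (weyl_alg p l m q) (weyl_alg p m l (inverse q))"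
  unfolding weyl_alg_def
proof (rule alg_isomorphic_presented_alg)
  let ?g = "\<lambda>v. case v of Gen_s \<Rightarrow> ncvar Gen_t | Gen_t \<Rightarrow> ncvar Gen_s | v \<Rightarrow> ncvar v"
  show "nc.ev ?g (?g v) = ncvar v" "nc.ev ?g (?g v) = ncvar v" for v
    by (cases v; simp add: nc_normalize)+
  have "nc.ev ?g r \<in> nc_ideal (weyl_relations p m l (inverse q))"
    if "r \<in> weyl_relations p l m q" "q \<noteq> 0" for r l m q
    using that unfolding weyl_relations_def[of p l m q] Let_def
    apply (elim insertE emptyE; hypsubst)
    subgoal by (rule nc_ideal_weyl(1)[where c = 1]) (simp add: nc_normalize)
    subgoal by (rule nc_ideal_weyl(2)[where c = "- q"]) (simp add: nc_normalize)
    subgoal by (rule nc_ideal_weyl(5)[where c = 1]) (simp add: nc_normalize)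
    subgoal by (rule nc_ideal_weyl(6)[where c = 1]) (simp add: nc_normalize)
    subgoal by (rule nc_ideal_weyl(3)[where c = 1]) (simp add: nc_normalize)
    subgoal by (rule nc_ideal_weyl(4)[where c = 1]) (simp add: nc_normalize)
    done
  note st = this
  show "nc.ev ?g r \<in> nc_ideal (weyl_relations p m l (inverse q))"
    if "r \<in> weyl_relations p l m q" for r
    using st that assms by simp
  show "nc.ev ?g r \<in> nc_ideal (weyl_relations p l m q)"
    if "r \<in> weyl_relations p m l (inverse q)" for r
    using st[of r m l "inverse q"] that assms by simp
qed

section \<open>Twisted group algebras\<close>

text \<open>A bicharacter \<open>c\<close> is in particular a 2-cocycle, so the product with \<open>X\<^sup>a X\<^sup>b = c(a, b) X\<^sup>a\<^sup>+\<^sup>b\<close> is associative.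
  Since the values are nonzero, leading terms multiply to leading terms over an ordered group, and commutation factors
  can be cancelled.\<close>

locale twisted_group_algebra =
  fixes c :: "'n::ab_group_add \<Rightarrow> 'n \<Rightarrow> 'r::idom"
  assumes c_add_left: "c (a + b) d = c a d * c b d"
    and c_add_right: "c d (a + b) = c d a * c d b"
    and c_nonzero [simp]: "c a b \<noteq> 0"
begin

lemma c_zero_left [simp]: "c 0 b = 1"
  using c_add_left[of 0 0 b] by simp

lemma c_zero_right [simp]: "c b 0 = 1"
  using c_add_right[of b 0 0] by simp

definition tmul :: "('n \<Rightarrow>\<^sub>0 'r) \<Rightarrow> ('n \<Rightarrow>\<^sub>0 'r) \<Rightarrow> ('n \<Rightarrow>\<^sub>0 'r)" (infixl "\<star>" 70)
  where "u \<star> v = additive_ext (\<lambda>a x. additive_ext (\<lambda>b y. single (a + b) (x * y * c a b)) v) u"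

lemma tmul_inner_add:
  "additive_ext (\<lambda>b y. single (a + b) ((x + x') * y * c a b)) v
    = additive_ext (\<lambda>b y. single (a + b) (x * y * c a b)) v
      + additive_ext (\<lambda>b y. single (a + b) (x' * y * c a b)) v"
  by (simp add: additive_ext_def ring_distribs single_add sum.distrib)

lemma tmul_add_left: "(u + v) \<star> w = u \<star> w + v \<star> w"
  unfolding tmul_def by (rule additive_ext_add) (rule tmul_inner_add)

lemma tmul_single_left: "single a x \<star> v = additive_ext (\<lambda>b y. single (a + b) (x * y * c a b)) v"
  unfolding tmul_def by (rule additive_ext_single) (rule tmul_inner_add)

lemma tmul_single_add_right: "single a x \<star> (u + v) = single a x \<star> u + single a x \<star> v"
  unfolding tmul_single_left by (rule additive_ext_add) (simp add: ring_distribs single_add)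

lemma tmul_add_right: "w \<star> (u + v) = w \<star> u + w \<star> v"
  by (induction w rule: poly_mapping_additive_induct)
    (simp_all add: tmul_single_add_right tmul_add_left algebra_simps)

lemma tmul_single: "single a x \<star> single b y = single (a + b) (x * y * c a b)"
  unfolding tmul_single_left by (rule additive_ext_single) (simp add: ring_distribs single_add)

lemma tmul_assoc: "(u \<star> v) \<star> w = u \<star> (v \<star> w)"
proof (induction u rule: poly_mapping_additive_induct)
  case u: (single a x)
  show ?case
  proof (induction v rule: poly_mapping_additive_induct)
    case v: (single b y)
    show ?case
    proof (induction w rule: poly_mapping_additive_induct)
      case (single d z)
      show ?case
        by (simp add: tmul_single c_add_left c_add_right add.assoc mult_ac)
    qed (simp add: tmul_add_right)
  qed (simp add: tmul_add_right tmul_add_left)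
qed (simp add: tmul_add_left)

lemma tmul_zero_left [simp]: "0 \<star> u = 0"
  using tmul_add_left[of 0 0 u] by simp

lemma tmul_zero_right [simp]: "u \<star> 0 = 0"
  using tmul_add_right[of u 0 0] by simp

lemma tmul_diff_right: "w \<star> (u - v) = w \<star> u - w \<star> v"
  using tmul_add_right[of w "u - v" v] by (simp add: eq_diff_eq)

lemma tmul_diff_left: "(u - v) \<star> w = u \<star> w - v \<star> w"
  using tmul_add_left[of "u - v" v w] by (simp add: eq_diff_eq)

lemma tmul_sum_left: "(\<Sum>i\<in>A. f i) \<star> u = (\<Sum>i\<in>A. f i \<star> u)"
  by (induction A rule: infinite_finite_induct) (simp_all add: tmul_add_left)

lemma tmul_sum_right: "u \<star> (\<Sum>i\<in>A. f i) = (\<Sum>i\<in>A. u \<star> f i)"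
  by (induction A rule: infinite_finite_induct) (simp_all add: tmul_add_right)

lemma tmul_one_left [simp]: "1 \<star> u = u"
  by (induction u rule: poly_mapping_additive_induct)
    (simp_all add: tmul_single tmul_add_right flip: single_one)

lemma tmul_one_right [simp]: "u \<star> 1 = u"
  by (induction u rule: poly_mapping_additive_induct)
    (simp_all add: tmul_single tmul_add_left flip: single_one)

lemma tmul_scalar_central: "u \<star> single 0 r = single 0 r \<star> u"
  by (induction u rule: poly_mapping_additive_induct)
    (simp_all add: tmul_single tmul_add_left tmul_add_right mult.commute)

lemma tmul_scalar_left_commute: "u \<star> (single 0 r \<star> v) = single 0 r \<star> (u \<star> v)"
  by (metis tmul_assoc tmul_scalar_central)

lemma lookup_tmul_single_left:
  "lookup (single e r \<star> u) n = r * lookup u (n - e) * c e (n - e)"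
proof (induction u rule: poly_mapping_additive_induct)
  case (single a x)
  have "e + a = n \<longleftrightarrow> a = n - e" by (auto simp: algebra_simps)
  then show ?case by (auto simp: tmul_single lookup_single when_def)
qed (simp add: tmul_add_right lookup_add algebra_simps)

lemma lookup_tmul_single_right:
  "lookup (u \<star> single e r) n = lookup u (n - e) * r * c (n - e) e"
proof (induction u rule: poly_mapping_additive_induct)
  case (single a x)
  have "a + e = n \<longleftrightarrow> a = n - e" by (auto simp: algebra_simps)
  then show ?case by (auto simp: tmul_single lookup_single when_def)
qed (simp add: tmul_add_left lookup_add algebra_simps)

lemma lookup_tmul_scalar [simp]: "lookup (single 0 r \<star> u) n = r * lookup u n"
  by (simp add: lookup_tmul_single_left)

lemma lookup_tmul: "lookup (u \<star> v) n = (\<Sum>a\<in>keys u. lookup u a * lookup v (n - a) * c a (n - a))"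
proof -
  have "u \<star> v = (\<Sum>a\<in>keys u. single a (lookup u a) \<star> v)"
    unfolding tmul_sum_left[symmetric] poly_mapping_sum_singles ..
  then show ?thesis by (simp add: lookup_sum lookup_tmul_single_left)
qed

lemma keys_tmul: "keys (u \<star> v) \<subseteq> {a + b | a b. a \<in> keys u \<and> b \<in> keys v}"
proof
  fix n assume "n \<in> keys (u \<star> v)"
  then have "(\<Sum>a\<in>keys u. lookup u a * lookup v (n - a) * c a (n - a)) \<noteq> 0"
    by (simp add: in_keys_iff lookup_tmul)
  then obtain a where "a \<in> keys u" "lookup v (n - a) \<noteq> 0"
    by (metis (no_types, lifting) mult_zero_left mult_zero_right sum.neutral)
  then show "n \<in> {a + b | a b. a \<in> keys u \<and> b \<in> keys v}"
    by (intro CollectI exI[of _ a] exI[of _ "n - a"]) (auto simp: in_keys_iff)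
qed

text \<open>Commutation with a monomial up to a scalar can be tested separately at each exponent of the other factor.\<close>

lemma skew_commuteI:
  assumes "\<And>n. n \<in> keys u \<Longrightarrow> c e n = k * c n e"
  shows "single e f \<star> u = single 0 k \<star> (u \<star> single e f)"
proof (rule poly_mapping_eqI)
  fix n
  show "lookup (single e f \<star> u) n = lookup (single 0 k \<star> (u \<star> single e f)) n"
    using assms[of "n - e"]
    by (cases "n - e \<in> keys u") (simp_all add: lookup_tmul_single_left lookup_tmul_single_right in_keys_iff mult_ac)
qed

lemma skew_commute_keys:
  assumes eq: "single e f \<star> u = single 0 k \<star> (u \<star> single e f)" and "f \<noteq> 0" "n \<in> keys u"
  shows "c e n = k * c n e"
proof -
  have "lookup (single e f \<star> u) (n + e) = lookup (single 0 k \<star> (u \<star> single e f)) (n + e)"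
    by (simp only: eq)
  then have "(f * lookup u n) * c e n = (f * lookup u n) * (k * c n e)"
    by (simp add: lookup_tmul_single_left lookup_tmul_single_right mult_ac)
  then show ?thesis using assms by (simp add: in_keys_iff)
qed

end

locale ordered_twisted_group_algebra = twisted_group_algebra c
  for c :: "'n::linordered_ab_group_add \<Rightarrow> 'n \<Rightarrow> 'r::idom"
begin

text \<open>The largest exponents of two factors, and likewise the smallest ones, add up to an exponent of the product that
  arises in only one way, so no cancellation can occur there.\<close>

lemma lookup_tmul_extreme:
  assumes a: "a \<in> keys u" and b: "b \<in> keys v"
    and extreme: "(\<forall>a'\<in>keys u. a' \<le> a) \<and> (\<forall>b'\<in>keys v. b' \<le> b) \<or> (\<forall>a'\<in>keys u. a \<le> a') \<and> (\<forall>b'\<in>keys v. b \<le> b')"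
  shows "a + b \<in> keys (u \<star> v)"
proof -
  have "lookup u a' * lookup v (a + b - a') * c a' (a + b - a') = 0"
    if a': "a' \<in> keys u - {a}" for a'
  proof (rule ccontr)
    assume "\<not> ?thesis"
    then have "a + b - a' \<in> keys v" by (auto simp: in_keys_iff)
    with extreme a' have "a' \<le> a \<and> a + b - a' \<le> b \<or> a \<le> a' \<and> b \<le> a + b - a'" by auto
    with a' show False by (auto simp: algebra_simps)
  qed
  then have "lookup (u \<star> v) (a + b) = lookup u a * lookup v (a + b - a) * c a (a + b - a)"
    unfolding lookup_tmul by (subst sum.remove[OF _ a]) (simp_all add: sum.neutral)
  then show ?thesis using a b by (simp add: in_keys_iff)
qed

text \<open>The largest exponent of \<open>v \<star> u\<close> is the sum of those of \<open>v\<close> and \<open>u\<close>, and that of \<open>u \<star> X\<^sup>e\<close> is \<open>e\<close> plus that of \<open>u\<close>;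
  so the largest exponent of \<open>v\<close> is \<open>e\<close>, and the same holds for the smallest one.\<close>

lemma tmul_eq_single_tmul:
  assumes eq: "u \<star> single e r = v \<star> u" and "u \<noteq> 0" "r \<noteq> 0"
  obtains k where "v = single e k" "k \<noteq> 0"
proof -
  have nonempty: "keys u \<noteq> {}" using \<open>u \<noteq> 0\<close> by (auto simp: poly_mapping_eq_iff fun_eq_iff in_keys_iff)
  have keys_eq: "keys (v \<star> u) = (\<lambda>a. a + e) ` keys u"
  proof -
    have "n \<in> keys (u \<star> single e r) \<longleftrightarrow> n - e \<in> keys u" for n
      using \<open>r \<noteq> 0\<close> by (simp add: in_keys_iff lookup_tmul_single_right)
    then show ?thesis unfolding eq[symmetric] by (force intro: image_eqI[where x = "_ - e"])
  qed
  have "v \<noteq> 0" using keys_eq nonempty by auto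
  then have nonempty': "keys v \<noteq> {}" by (auto simp: poly_mapping_eq_iff fun_eq_iff in_keys_iff)
  have "b \<le> e" if "b \<in> keys v" for b
  proof -
    have "Max (keys v) + Max (keys u) \<in> keys (v \<star> u)"
      using nonempty nonempty' by (intro lookup_tmul_extreme) simp_all
    then obtain a where a: "a \<in> keys u" "Max (keys v) + Max (keys u) = a + e" by (auto simp: keys_eq)
    have "b + Max (keys u) \<le> Max (keys v) + Max (keys u)" using that by (simp add: add_right_mono)
    also have "\<dots> \<le> Max (keys u) + e" using a by (simp add: add_right_mono)
    finally show ?thesis by (simp add: add.commute)
  qed
  moreover have "e \<le> b" if "b \<in> keys v" for b
  proof -
    have "Min (keys v) + Min (keys u) \<in> keys (v \<star> u)"
      using nonempty nonempty' by (intro lookup_tmul_extreme) simp_all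
    then obtain a where a: "a \<in> keys u" "Min (keys v) + Min (keys u) = a + e" by (auto simp: keys_eq)
    have "Min (keys u) + e \<le> Min (keys v) + Min (keys u)" using a by (simp add: add_right_mono)
    also have "\<dots> \<le> b + Min (keys u)" using that by (simp add: add_right_mono)
    finally show ?thesis by (simp add: add.commute)
  qed
  ultimately have "b = e" if "b \<in> keys v" for b using that by (simp add: order_antisym)
  then have keys_v: "keys v = {e}" using nonempty' by blast
  then have "v = single e (lookup v e)"
    by (intro poly_mapping_eqI) (auto simp: lookup_single when_def in_keys_iff)
  moreover have "lookup v e \<noteq> 0" using keys_v by (simp flip: in_keys_iff)
  ultimately show ?thesis by (rule that)
qed

end

text \<open>The lexicographic order makes exponents in \<open>\<int>\<^sup>4\<close> an ordered group.\<close>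

instance prod :: (linordered_ab_group_add, linordered_ab_group_add) linordered_ab_group_add
  by standard (auto simp: less_eq_prod_def)

section \<open>Realisation in a twisted group algebra of \<open>\<int>\<^sup>4\<close>\<close>

text \<open>The exponent \<open>(i, d, a, b)\<close> stands for the monomial \<open>z\<^sup>d x\<^sup>i s\<^sup>a t\<^sup>b\<close>, with \<open>z\<close> to the left of \<open>x\<close>.\<close>

type_synonym exponent = "int \<times> int \<times> int \<times> int"

lemma power_int_eq_iff_generic:
  fixes g :: "'k::field"
  assumes "g \<noteq> 0" "\<not> root_of_unity g"
  shows "g powi i = g powi j \<longleftrightarrow> i = j"
proof -
  have False if "g powi i = g powi j" "i < j" for i j
  proof -
    have "g powi (j - i) = 1" using that assms(1) by (simp add: power_int_diff)
    then have "g ^ nat (j - i) = 1" using that(2) by (simp add: power_int_def)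
    moreover have "0 < nat (j - i)" using that(2) by simp
    ultimately show False using assms(2) unfolding root_of_unity_def by blast
  qed
  then show ?thesis by (metis linorder_neq_iff)
qed

lemma zero_exponent: "(0, 0, 0, 0) = (0 :: exponent)"
  by (simp add: zero_prod_def)

locale weyl_parameters =
  fixes p l m q :: "'k::field"
  assumes p_nonzero [simp]: "p \<noteq> 0" and l_nonzero [simp]: "l \<noteq> 0"
    and m_nonzero [simp]: "m \<noteq> 0" and q_nonzero [simp]: "q \<noteq> 0"
    and p_generic: "\<not> root_of_unity p" and q_generic: "\<not> root_of_unity q"
begin

text \<open>The factor that appears when \<open>z\<^sup>d x\<^sup>i s\<^sup>a t\<^sup>b \<cdot> z\<^sup>d\<^sup>' x\<^sup>i\<^sup>' s\<^sup>a\<^sup>' t\<^sup>b\<^sup>'\<close> is put into normal order by means of \<open>xz = pzx\<close>,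
  \<open>sx = lxs\<close>, \<open>tx = mxt\<close> and \<open>ts = q\<^sup>-\<^sup>1 st\<close>.\<close>

fun bichar :: "exponent \<Rightarrow> exponent \<Rightarrow> 'k"
  where "bichar (i, d, a, b) (i', d', a', b') =
    p powi (i * d') * l powi (a * i') * m powi (b * i') * q powi (- (b * a'))"

text \<open>The coefficients are polynomials in \<open>w\<close>; the twist only involves constants.\<close>

definition cocycle :: "exponent \<Rightarrow> exponent \<Rightarrow> 'k poly"
  where "cocycle n n' = [:bichar n n':]"

lemma cocycle_tuple: "cocycle (i, d, a, b) (i', d', a', b') =
    [:p powi (i * d') * l powi (a * i') * m powi (b * i') * q powi (- (b * a')):]"
  by (simp add: cocycle_def)

sublocale ordered_twisted_group_algebra cocycle
proof
  fix a b d :: exponent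
  show "cocycle (a + b) d = cocycle a d * cocycle b d"
    by (cases a; cases b; cases d)
      (simp add: cocycle_def power_int_add power_int_diff power_int_minus divide_inverse ring_distribs mult_ac)
  show "cocycle d (a + b) = cocycle d a * cocycle d b"
    by (cases a; cases b; cases d)
      (simp add: cocycle_def power_int_add power_int_diff power_int_minus divide_inverse ring_distribs mult_ac)
  show "cocycle a b \<noteq> 0"
    by (cases a; cases b) (simp add: cocycle_def)
qed

notation tmul (infixl "\<star>" 70)

abbreviation scalar :: "'k poly \<Rightarrow> exponent \<Rightarrow>\<^sub>0 'k poly"
  where "scalar r \<equiv> single 0 r"

sublocale T: type_algebra "(\<star>)" 1 "\<lambda>r u. scalar [:r:] \<star> u"
proof
  fix a b :: 'k and u v :: "exponent \<Rightarrow>\<^sub>0 'k poly"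
  have "[:a + b:] = [:a:] + [:b:]" by simp
  then show "scalar [:a + b:] \<star> u = scalar [:a:] \<star> u + scalar [:b:] \<star> u"
    by (metis single_add tmul_add_left)
  show "scalar [:a:] \<star> (scalar [:b:] \<star> u) = scalar [:a * b:] \<star> u"
    by (simp add: tmul_single mult.commute flip: tmul_assoc)
  show "scalar [:1:] \<star> u = u" by (simp flip: one_pCons)
qed (simp_all add: tmul_assoc tmul_add_left tmul_add_right tmul_scalar_left_commute)

lemma p_neq_one [simp]: "p \<noteq> 1"
  using p_generic by (auto simp: root_of_unity_def)

abbreviation X where "X \<equiv> single (1, 0, 0, 0) 1 :: exponent \<Rightarrow>\<^sub>0 'k poly"
abbreviation Z where "Z \<equiv> single (0, 1, 0, 0) 1 :: exponent \<Rightarrow>\<^sub>0 'k poly"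
abbreviation S where "S \<equiv> single (0, 0, 1, 0) 1 :: exponent \<Rightarrow>\<^sub>0 'k poly"
abbreviation T where "T \<equiv> single (0, 0, 0, 1) 1 :: exponent \<Rightarrow>\<^sub>0 'k poly"

text \<open>The element \<open>(z - 1)x\<^sup>-\<^sup>1 / (p - 1)\<close>.\<close>

definition Y :: "exponent \<Rightarrow>\<^sub>0 'k poly"
  where "Y = single (-1, 1, 0, 0) [:1 / (p - 1):] - single (-1, 0, 0, 0) [:1 / (p - 1):]"

lemma keys_Y: "n \<in> keys Y \<Longrightarrow> n = (-1, 1, 0, 0) \<or> n = (-1, 0, 0, 0)"
  by (auto simp: Y_def in_keys_iff lookup_minus lookup_single when_def split: if_splits)

fun gen_val :: "gen \<Rightarrow> exponent \<Rightarrow>\<^sub>0 'k poly"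
  where "gen_val Gen_x = X" | "gen_val Gen_y = Y" | "gen_val Gen_s = S" | "gen_val Gen_t = T"

abbreviation val :: "(gen, 'k) ncpoly \<Rightarrow> exponent \<Rightarrow>\<^sub>0 'k poly"
  where "val \<equiv> T.ev gen_val"

abbreviation rels :: "(gen, 'k) ncpoly set"
  where "rels \<equiv> weyl_relations p l m q"

lemma val_relations:
  assumes "r \<in> rels"
  shows "val r = 0"
proof -
  have "p / (p - 1) - 1 / (p - 1) = 1" by (simp flip: diff_divide_distrib)
  then have xy: "scalar [:p / (p - 1):] - scalar [:1 / (p - 1):] = 1"
    by (simp flip: single_diff one_pCons)
  have "scalar [:p:] \<star> Y \<star> X = single (0, 1, 0, 0) [:p / (p - 1):] - single (0, 0, 0, 0) [:p / (p - 1):]"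
    "X \<star> Y = single (0, 1, 0, 0) [:p / (p - 1):] - single (0, 0, 0, 0) [:1 / (p - 1):]"
    by (simp_all add: Y_def tmul_diff_left tmul_diff_right tmul_single cocycle_tuple zero_exponent)
  then have "X \<star> Y - scalar [:p:] \<star> Y \<star> X - 1 = 0"
    using xy by (simp add: zero_exponent)
  moreover have "S \<star> T - scalar [:q:] \<star> T \<star> S = 0" "S \<star> X - scalar [:l:] \<star> X \<star> S = 0"
    "T \<star> X - scalar [:m:] \<star> X \<star> T = 0"
    by (simp_all add: tmul_single cocycle_tuple zero_exponent power_int_minus flip: one_pCons)
  moreover have "S \<star> Y - scalar [:inverse l:] \<star> Y \<star> S = 0"
    "T \<star> Y - scalar [:inverse m:] \<star> Y \<star> T = 0"
    by (simp_all add: Y_def tmul_diff_left tmul_diff_right tmul_single cocycle_tuple zero_exponent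
        power_int_minus)
  ultimately show ?thesis
    using assms by (auto simp: weyl_relations_def Let_def T.ev_simps T.ev_ncconst)
qed

lemma val_ideal:
  assumes "f \<in> nc_ideal rels"
  shows "val f = 0"
proof -
  have "ideal {f. val f = 0} free_alg"
    by (rule ideal_free_algI) (simp_all add: T.ev_simps)
  then show ?thesis
    using nc_ideal_minimal[of "{f. val f = 0}" rels] val_relations assms by auto
qed

section \<open>The basis of ordered monomials\<close>

abbreviation "x\<^sub>f \<equiv> ncvar Gen_x :: (gen, 'k) ncpoly"
abbreviation "y\<^sub>f \<equiv> ncvar Gen_y :: (gen, 'k) ncpoly"
abbreviation "s\<^sub>f \<equiv> ncvar Gen_s :: (gen, 'k) ncpoly"
abbreviation "t\<^sub>f \<equiv> ncvar Gen_t :: (gen, 'k) ncpoly"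

definition cong :: "(gen, 'k) ncpoly \<Rightarrow> (gen, 'k) ncpoly \<Rightarrow> bool" (infix "\<approx>" 50)
  where "f \<approx> g \<longleftrightarrow> f - g \<in> nc_ideal rels"

lemmas ideal_rels = ideal_free_algD[OF ideal_presented_alg[of rels]]

lemma cong_refl [simp]: "f \<approx> f"
  by (simp add: cong_def ideal_rels(1))

lemma cong_sym: "f \<approx> g \<Longrightarrow> g \<approx> f"
  using ideal_rels(3)[of "f - g"] by (simp add: cong_def)

lemma cong_trans [trans]: "f \<approx> g \<Longrightarrow> g \<approx> h \<Longrightarrow> f \<approx> h"
  using ideal_rels(2)[of "f - g" "g - h"] by (simp add: cong_def)

lemma cong_add: "f \<approx> f' \<Longrightarrow> g \<approx> g' \<Longrightarrow> f + g \<approx> f' + g'"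
  using ideal_rels(2)[of "f - f'" "g - g'"] by (simp add: cong_def algebra_simps)

lemma cong_left: "f \<approx> f' \<Longrightarrow> g * f \<approx> g * f'"
  using ideal_rels(4)[of "f - f'" g] by (simp add: cong_def algebra_simps)

lemma cong_right: "f \<approx> f' \<Longrightarrow> f * g \<approx> f' * g"
  using ideal_rels(5)[of "f - f'" g] by (simp add: cong_def algebra_simps)

lemma cong_relation: "f - g \<in> rels \<Longrightarrow> f \<approx> g"
  using nc_ideal_superset[of rels] by (auto simp: cong_def)

lemma cong_commutations:
  "x\<^sub>f * y\<^sub>f \<approx> ncconst p * (y\<^sub>f * x\<^sub>f) + 1"
  "t\<^sub>f * s\<^sub>f \<approx> ncconst (inverse q) * (s\<^sub>f * t\<^sub>f)"
  "s\<^sub>f * x\<^sub>f \<approx> ncconst l * (x\<^sub>f * s\<^sub>f)"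
  "s\<^sub>f * y\<^sub>f \<approx> ncconst (inverse l) * (y\<^sub>f * s\<^sub>f)"
  "t\<^sub>f * x\<^sub>f \<approx> ncconst m * (x\<^sub>f * t\<^sub>f)"
  "t\<^sub>f * y\<^sub>f \<approx> ncconst (inverse m) * (y\<^sub>f * t\<^sub>f)"
proof -
  have "s\<^sub>f * t\<^sub>f \<approx> ncconst q * (t\<^sub>f * s\<^sub>f)"
    by (rule cong_relation) (simp add: weyl_relations_def Let_def mult.assoc)
  from cong_sym[OF cong_left[OF this, of "ncconst (inverse q)"]]
  show "t\<^sub>f * s\<^sub>f \<approx> ncconst (inverse q) * (s\<^sub>f * t\<^sub>f)"
    by (simp add: ncconst_ncconst)
qed (rule cong_relation; simp add: weyl_relations_def Let_def mult.assoc diff_diff_add)+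

lemma skew_commute_power:
  assumes "g * h \<approx> ncconst k * (h * g)"
  shows "g * h ^ n \<approx> ncconst (k ^ n) * (h ^ n * g)"
proof (induction n)
  case (Suc n)
  have "g * h ^ Suc n = g * h * h ^ n" by (simp add: mult.assoc)
  also have "\<dots> \<approx> ncconst k * (h * g) * h ^ n" by (rule cong_right) (rule assms)
  also have "\<dots> = ncconst k * h * (g * h ^ n)" by (simp add: mult.assoc)
  also have "\<dots> \<approx> ncconst k * h * (ncconst (k ^ n) * (h ^ n * g))" by (rule cong_left) (rule Suc)
  also have "\<dots> = ncconst (k ^ Suc n) * (h ^ Suc n * g)"
    by (simp add: mult.assoc ncconst_left_commute[of h] ncconst_ncconst)
  finally show ?case .
qed simp

text \<open>The coefficient \<open>d\<close> is the \<open>p\<close>-number \<open>1 + p + \<dots> + p\<^sup>j\<close>, but only the shape of the result matters: moving \<open>x\<close> past a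
  power of \<open>y\<close> does not leave the span of ordered monomials.\<close>

lemma x_y_power: "\<exists>d. x\<^sub>f * y\<^sub>f ^ Suc j \<approx> ncconst (p ^ Suc j) * (y\<^sub>f ^ Suc j * x\<^sub>f) + ncconst d * y\<^sub>f ^ j"
proof (induction j)
  case 0
  show ?case using cong_commutations(1) by (intro exI[of _ 1]) simp
next
  case (Suc j)
  then obtain d where d: "x\<^sub>f * y\<^sub>f ^ Suc j \<approx> ncconst (p ^ Suc j) * (y\<^sub>f ^ Suc j * x\<^sub>f) + ncconst d * y\<^sub>f ^ j" ..
  have "x\<^sub>f * y\<^sub>f ^ Suc (Suc j) = x\<^sub>f * y\<^sub>f * y\<^sub>f ^ Suc j" by (simp add: mult.assoc)
  also have "\<dots> \<approx> (ncconst p * (y\<^sub>f * x\<^sub>f) + 1) * y\<^sub>f ^ Suc j"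
    by (rule cong_right) (rule cong_commutations)
  also have "\<dots> = ncconst p * y\<^sub>f * (x\<^sub>f * y\<^sub>f ^ Suc j) + y\<^sub>f ^ Suc j"
    by (simp add: distrib_right mult.assoc)
  also have "\<dots> \<approx> ncconst p * y\<^sub>f * (ncconst (p ^ Suc j) * (y\<^sub>f ^ Suc j * x\<^sub>f) + ncconst d * y\<^sub>f ^ j) + y\<^sub>f ^ Suc j"
    by (intro cong_add cong_left d cong_refl)
  also have "\<dots> = ncconst (p ^ Suc (Suc j)) * (y\<^sub>f ^ Suc (Suc j) * x\<^sub>f) + ncconst (p * d + 1) * y\<^sub>f ^ Suc j"
    by (simp add: mult.assoc ncvar_ncconst ncconst_ncconst distrib_left ncconst_add distrib_right add.assoc)
  finally show ?case by blast
qed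

definition pbw :: "nat \<times> nat \<times> nat \<times> nat \<Rightarrow> (gen, 'k) ncpoly"
  where "pbw = (\<lambda>(j, i, a, b). y\<^sub>f ^ j * x\<^sub>f ^ i * s\<^sub>f ^ a * t\<^sub>f ^ b)"

definition comb :: "(nat \<times> nat \<times> nat \<times> nat \<Rightarrow>\<^sub>0 'k) \<Rightarrow> (gen, 'k) ncpoly"
  where "comb = additive_ext (\<lambda>k r. ncconst r * pbw k)"

lemma comb_add: "comb (F + G) = comb F + comb G"
  unfolding comb_def by (rule additive_ext_add) (simp add: ncconst_add distrib_right)

lemma comb_single: "comb (single k r) = ncconst r * pbw k"
  unfolding comb_def by (rule additive_ext_single) (simp add: ncconst_add distrib_right)

definition spanned :: "(gen, 'k) ncpoly \<Rightarrow> bool"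
  where "spanned f \<longleftrightarrow> (\<exists>F. f \<approx> comb F)"

lemma spanned_cong: "f \<approx> g \<Longrightarrow> spanned g \<Longrightarrow> spanned f"
  unfolding spanned_def using cong_trans by blast

lemma spanned_add: "spanned f \<Longrightarrow> spanned g \<Longrightarrow> spanned (f + g)"
  unfolding spanned_def using cong_add comb_add by metis

lemma spanned_pbw: "spanned (ncconst r * pbw k)"
  unfolding spanned_def using comb_single cong_refl by metis

lemma spanned_mult:
  assumes "\<And>r k. spanned (g * (ncconst r * pbw k))" "spanned f"
  shows "spanned (g * f)"
proof -
  have "spanned (g * comb F)" for F
    by (induction F rule: poly_mapping_additive_induct)
      (simp_all add: comb_single comb_add distrib_left assms(1) spanned_add)
  then show ?thesis using assms(2) spanned_cong cong_left by (metis spanned_def)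
qed

lemma spanned_scaled: "spanned f \<Longrightarrow> spanned (ncconst r * f)"
  by (rule spanned_mult) (simp_all add: ncconst_ncconst spanned_pbw)

lemma spanned_pbw': "spanned (y\<^sub>f ^ j * (x\<^sub>f ^ i * (s\<^sub>f ^ a * t\<^sub>f ^ b)))"
  using spanned_pbw[of 1 "(j, i, a, b)"] by (simp add: pbw_def mult.assoc)

lemma spanned_y: "spanned (y\<^sub>f * pbw k)"
proof (cases k)
  case (fields j i a b)
  then show ?thesis using spanned_pbw'[of "Suc j"] by (simp add: pbw_def mult.assoc)
qed

lemma spanned_x: "spanned (x\<^sub>f * pbw k)"
proof (cases k)
  case (fields j i a b)
  let ?v = "x\<^sub>f ^ i * (s\<^sub>f ^ a * t\<^sub>f ^ b)"
  show ?thesis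
  proof (cases j)
    case 0
    then show ?thesis using spanned_pbw'[of 0 "Suc i" a b] by (simp add: pbw_def mult.assoc fields)
  next
    case (Suc j')
    obtain d where d: "x\<^sub>f * y\<^sub>f ^ j \<approx> ncconst (p ^ j) * (y\<^sub>f ^ j * x\<^sub>f) + ncconst d * y\<^sub>f ^ j'"
      using x_y_power[of j'] Suc by auto
    have "x\<^sub>f * pbw k = x\<^sub>f * y\<^sub>f ^ j * ?v" by (simp add: pbw_def mult.assoc fields)
    also have "\<dots> \<approx> (ncconst (p ^ j) * (y\<^sub>f ^ j * x\<^sub>f) + ncconst d * y\<^sub>f ^ j') * ?v"
      by (rule cong_right) (rule d)
    also have "\<dots> = ncconst (p ^ j) * (y\<^sub>f ^ j * (x\<^sub>f ^ Suc i * (s\<^sub>f ^ a * t\<^sub>f ^ b)))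
        + ncconst d * (y\<^sub>f ^ j' * ?v)" (is "_ = ?w")
      by (simp add: distrib_right mult.assoc)
    finally have "x\<^sub>f * pbw k \<approx> ?w" .
    moreover have "spanned ?w" by (intro spanned_add spanned_scaled spanned_pbw')
    ultimately show ?thesis by (rule spanned_cong)
  qed
qed

lemma cong_swap: "g * h \<approx> ncconst r * (h * g) \<Longrightarrow> g * (h * v) \<approx> ncconst r * (h * (g * v))"
  using cong_right[of "g * h" "ncconst r * (h * g)" v] by (simp add: mult.assoc)

lemma spanned_swap:
  assumes "g * h \<approx> ncconst r * (h * g)" "spanned (h ^ n * (g * v))"
  shows "spanned (g * (h ^ n * v))"
  using cong_swap[OF skew_commute_power[OF assms(1)]] spanned_scaled[OF assms(2)]
  by (rule spanned_cong)

lemma spanned_left_power: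
  assumes "g * h \<approx> ncconst r * (h * g)" "g * h' \<approx> ncconst r' * (h' * g)"
    "spanned (h ^ n * (h' ^ n' * (g * v)))"
  shows "spanned (g * (h ^ n * (h' ^ n' * v)))"
proof (rule spanned_swap[OF assms(1)])
  have "h ^ n * (g * (h' ^ n' * v)) \<approx> h ^ n * (ncconst (r' ^ n') * (h' ^ n' * (g * v)))"
    by (rule cong_left) (rule cong_swap[OF skew_commute_power[OF assms(2)]])
  also have "\<dots> = ncconst (r' ^ n') * (h ^ n * (h' ^ n' * (g * v)))"
    by (rule ncconst_left_commute)
  finally show "spanned (h ^ n * (g * (h' ^ n' * v)))"
    using spanned_scaled[OF assms(3)] by (rule spanned_cong)
qed

lemma spanned_s: "spanned (s\<^sub>f * pbw k)"
proof (cases k)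
  case (fields j i a b)
  have "spanned (s\<^sub>f * (y\<^sub>f ^ j * (x\<^sub>f ^ i * (s\<^sub>f ^ a * t\<^sub>f ^ b))))"
    using spanned_pbw'[of j i "Suc a" b]
    by (intro spanned_left_power[OF cong_commutations(4,3)]) (simp add: mult.assoc)
  then show ?thesis by (simp add: pbw_def mult.assoc fields)
qed

lemma spanned_t: "spanned (t\<^sub>f * pbw k)"
proof (cases k)
  case (fields j i a b)
  have ts: "t\<^sub>f * (s\<^sub>f ^ a * t\<^sub>f ^ b) \<approx> ncconst (inverse q ^ a) * (s\<^sub>f ^ a * t\<^sub>f ^ Suc b)"
    using cong_swap[OF skew_commute_power[OF cong_commutations(2)]] by simp
  have "y\<^sub>f ^ j * (x\<^sub>f ^ i * (t\<^sub>f * (s\<^sub>f ^ a * t\<^sub>f ^ b)))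
      \<approx> y\<^sub>f ^ j * (x\<^sub>f ^ i * (ncconst (inverse q ^ a) * (s\<^sub>f ^ a * t\<^sub>f ^ Suc b)))"
    by (intro cong_left ts)
  also have "\<dots> = ncconst (inverse q ^ a) * (y\<^sub>f ^ j * (x\<^sub>f ^ i * (s\<^sub>f ^ a * t\<^sub>f ^ Suc b)))"
    by (simp only: ncconst_left_commute[of "x\<^sub>f ^ i"] ncconst_left_commute[of "y\<^sub>f ^ j"])
  finally have "spanned (y\<^sub>f ^ j * (x\<^sub>f ^ i * (t\<^sub>f * (s\<^sub>f ^ a * t\<^sub>f ^ b))))"
    using spanned_scaled[OF spanned_pbw'] by (rule spanned_cong)
  then have "spanned (t\<^sub>f * (y\<^sub>f ^ j * (x\<^sub>f ^ i * (s\<^sub>f ^ a * t\<^sub>f ^ b))))"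
    by (rule spanned_left_power[OF cong_commutations(6,5)])
  then show ?thesis by (simp add: pbw_def mult.assoc fields)
qed

text \<open>The span of the ordered monomials modulo the relations contains the constants and is stable under left
  multiplication by each generator.\<close>

lemma spanned_all: "spanned f"
proof (induction f rule: ncpoly_induct)
  case (const r)
  show ?case using spanned_pbw[of r "(0, 0, 0, 0)"] by (simp add: pbw_def)
next
  case (var v f)
  have "spanned (ncvar v * pbw k)" for k
    using spanned_x spanned_y spanned_s spanned_t by (cases v) simp_all
  then have "spanned (ncvar v * (ncconst r * pbw k))" for r k
    by (simp add: ncvar_ncconst spanned_scaled)
  then show ?case using var by (rule spanned_mult)
qed (rule spanned_add)

text \<open>Since \<open>y\<close> is \<open>(z - 1)x\<^sup>-\<^sup>1\<close> up to a scalar, \<open>y\<^sup>j\<close> is \<open>x\<^sup>-\<^sup>j\<close> times a polynomial of degree \<open>j\<close> in \<open>z\<close>.\<close>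

lemma val_y_power_keys:
  assumes "n \<in> keys (val (y\<^sub>f ^ j))"
  shows "\<exists>d. n = (- int j, d, 0, 0) \<and> 0 \<le> d \<and> d \<le> int j"
  using assms
proof (induction j arbitrary: n)
  case 0
  then show ?case by (intro exI[of _ 0]) (simp add: T.ev_simps zero_exponent)
next
  case (Suc j)
  from Suc.prems have "n \<in> keys (Y \<star> val (y\<^sub>f ^ j))" by (simp add: T.ev_simps)
  then obtain n\<^sub>1 n\<^sub>2 where n: "n = n\<^sub>1 + n\<^sub>2" "n\<^sub>1 \<in> keys Y" "n\<^sub>2 \<in> keys (val (y\<^sub>f ^ j))"
    using keys_tmul by blast
  then have "n\<^sub>1 \<in> {(-1, 1, 0, 0), (-1, 0, 0, 0)}"
    by (auto simp: Y_def in_keys_iff lookup_minus lookup_single when_def split: if_splits)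
  then show ?case using Suc.IH[OF n(3)] n(1) by auto
qed

lemma lookup_Y_tmul:
  "lookup (Y \<star> u) (i, d, a, b) =
    [:1 / (p - 1):] * (lookup u (i + 1, d - 1, a, b) * [:p powi (1 - d):])
    - [:1 / (p - 1):] * (lookup u (i + 1, d, a, b) * [:p powi - d:])"
  by (simp add: Y_def tmul_diff_left lookup_minus lookup_tmul_single_left cocycle_tuple mult.commute)

lemma lookup_val_y_power: "lookup (val (y\<^sub>f ^ j)) (- int j, int j, 0, 0) \<noteq> 0"
proof (induction j)
  case 0
  show ?case by (simp add: T.ev_simps lookup_one zero_exponent)
next
  case (Suc j)
  have "(- int j, 1 + int j, 0, 0) \<notin> keys (val (y\<^sub>f ^ j))"
    using val_y_power_keys by fastforce
  then have "lookup (val (y\<^sub>f ^ j)) (- int j, 1 + int j, 0, 0) = 0" by (simp add: in_keys_iff)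
  then show ?case using Suc by (simp add: T.ev_simps lookup_Y_tmul)
qed

lemma val_monomial: "val (x\<^sub>f ^ i * (s\<^sub>f ^ a * t\<^sub>f ^ b)) = single (int i, 0, int a, int b) 1"
proof -
  have "val (x\<^sub>f ^ i) = single (int i, 0, 0, 0) 1"
    by (induction i) (simp_all add: T.ev_simps tmul_single cocycle_tuple zero_exponent flip: one_pCons)
  moreover have "val (s\<^sub>f ^ a) = single (0, 0, int a, 0) 1"
    by (induction a) (simp_all add: T.ev_simps tmul_single cocycle_tuple zero_exponent flip: one_pCons)
  moreover have "val (t\<^sub>f ^ b) = single (0, 0, 0, int b) 1"
    by (induction b) (simp_all add: T.ev_simps tmul_single cocycle_tuple zero_exponent flip: one_pCons)
  ultimately show ?thesis
    by (simp add: T.ev_simps tmul_single cocycle_tuple flip: one_pCons)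
qed

lemma val_pbw: "val (pbw (j, i, a, b)) = val (y\<^sub>f ^ j) \<star> single (int i, 0, int a, int b) 1"
  by (simp add: pbw_def mult.assoc T.ev_mult[of _ "y\<^sub>f ^ j"] val_monomial)

lemma keys_val_pbw:
  assumes "n \<in> keys (val (pbw (j, i, a, b)))"
  shows "\<exists>d. n = (int i - int j, d, int a, int b) \<and> 0 \<le> d \<and> d \<le> int j"
proof -
  have "n - (int i, 0, int a, int b) \<in> keys (val (y\<^sub>f ^ j))"
    using assms by (simp add: val_pbw in_keys_iff lookup_tmul_single_right)
  from val_y_power_keys[OF this] show ?thesis by (cases n) auto
qed

lemma lookup_val_pbw_top:
  "lookup (val (pbw (j, i, a, b))) (int i - int j, int j, int a, int b) \<noteq> 0"
proof -
  have "(int i - int j, int j, int a, int b) - (int i, 0, int a, int b) = (- int j, int j, 0, 0)"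
    by (simp add: zero_prod_def)
  then show ?thesis
    using lookup_val_y_power[of j] by (simp add: val_pbw lookup_tmul_single_right del: diff_Pair)
qed

lemma lookup_val_comb:
  "lookup (val (comb F)) n = (\<Sum>k\<in>keys F. [:lookup F k:] * lookup (val (pbw k)) n)"
proof -
  have "comb F = (\<Sum>k\<in>keys F. ncconst (lookup F k) * pbw k)"
    by (simp add: comb_def additive_ext_def)
  moreover have "val (\<Sum>k\<in>A. g k) = (\<Sum>k\<in>A. val (g k))" for A and g :: "nat \<times> nat \<times> nat \<times> nat \<Rightarrow> _"
    by (induction A rule: infinite_finite_induct) (simp_all add: T.ev_simps)
  ultimately show ?thesis by (simp add: T.ev_scaled lookup_sum)
qed

text \<open>The monomial \<open>y\<^sup>j x\<^sup>i s\<^sup>a t\<^sup>b\<close> has \<open>x\<close>-degree \<open>i - j\<close> and \<open>z\<close>-degree \<open>j\<close>. Among the monomials of a linear combination, one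
  with maximal \<open>j\<close> is therefore the only one that contributes to the coefficient of its leading term.\<close>

lemma val_comb_nonzero:
  assumes "F \<noteq> 0"
  shows "val (comb F) \<noteq> 0"
proof -
  have "keys F \<noteq> {}" using assms by (auto simp: poly_mapping_eq_iff fun_eq_iff in_keys_iff)
  then have "Max (fst ` keys F) \<in> fst ` keys F" by (intro Max_in) auto
  then obtain j i a b where k: "(j, i, a, b) \<in> keys F" and j: "j = Max (fst ` keys F)" by force
  have max: "j' \<le> j" if "(j', r) \<in> keys F" for j' r
    using that unfolding j by (intro Max_ge) force+
  have "lookup (val (pbw k')) (int i - int j, int j, int a, int b) = 0"
    if k': "k' \<in> keys F - {(j, i, a, b)}" for k'
  proof (cases k')
    case (fields j' i' a' b')
    have "j' \<le> j" "(j', i', a', b') \<noteq> (j, i, a, b)" using k' max fields by auto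
    then have "(int i - int j, int j, int a, int b) \<notin> keys (val (pbw (j', i', a', b')))"
      using keys_val_pbw[of "(int i - int j, int j, int a, int b)" j' i' a' b'] by auto
    then show ?thesis by (simp add: in_keys_iff fields)
  qed
  then have "lookup (val (comb F)) (int i - int j, int j, int a, int b)
      = [:lookup F (j, i, a, b):] * lookup (val (pbw (j, i, a, b))) (int i - int j, int j, int a, int b)"
    unfolding lookup_val_comb by (subst sum.remove[OF _ k]) (simp_all add: sum.neutral)
  then have "lookup (val (comb F)) (int i - int j, int j, int a, int b) \<noteq> 0"
    using k lookup_val_pbw_top by (simp add: in_keys_iff)
  then show ?thesis by auto
qed

text \<open>Spanning reduces an element of the kernel to a combination of ordered monomials, and independence then shows that
  the combination is zero: the kernel is the ideal generated by the relations.\<close>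

lemma val_eq_iff: "val f = val g \<longleftrightarrow> f \<approx> g"
proof
  assume "f \<approx> g"
  then show "val f = val g" using val_ideal[of "f - g"] by (simp add: cong_def T.ev_simps)
next
  assume eq: "val f = val g"
  obtain F where F: "f - g \<approx> comb F" using spanned_all spanned_def by blast
  then have "val (f - g - comb F) = 0" by (intro val_ideal) (simp add: cong_def)
  then have "val (comb F) = 0" using eq by (simp add: T.ev_simps)
  then have "F = 0" using val_comb_nonzero by blast
  then show "f \<approx> g" using F by (simp add: comb_def additive_ext_def cong_def)
qed

lemma val_coeff_constant: "\<exists>r. lookup (val f) n = [:r:]"
proof (induction f arbitrary: n rule: ncpoly_induct)
  case (const r)
  show ?case
    by (intro exI[of _ "if n = 0 then r else 0"]) (simp add: T.ev_ncconst lookup_single when_def)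
next
  case (add f g)
  obtain a b where "lookup (val f) n = [:a:]" "lookup (val g) n = [:b:]" using add by blast
  then show ?case by (simp add: T.ev_add lookup_add)
next
  case (var v f)
  have shift: "\<exists>r. lookup (single e [:k:] \<star> val f) n = [:r:]" for e k
  proof -
    obtain r where "lookup (val f) (n - e) = [:r:]" using var by blast
    then show ?thesis by (simp add: lookup_tmul_single_left cocycle_def)
  qed
  have minus: "\<exists>r. lookup (u - v) n = [:r:]"
    if "\<exists>r. lookup u n = [:r:]" "\<exists>r. lookup v n = [:r:]" for u v :: "exponent \<Rightarrow>\<^sub>0 'k poly"
    using that by (auto simp: lookup_minus)
  have unit: "\<exists>r. lookup (single e 1 \<star> val f) n = [:r:]" for e
    using shift[of e 1] by (simp only: pCons_one)
  have "\<exists>r. lookup (Y \<star> val f) n = [:r:]"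
    unfolding Y_def tmul_diff_left by (intro minus shift)
  with unit show ?case by (cases v) (simp_all only: T.ev_mult T.ev_ncvar gen_val.simps)
qed

section \<open>Embedding of the polynomial extension\<close>

abbreviation "A \<equiv> weyl_alg p l m q"
abbreviation "B \<equiv> poly_alg A"

interpretation A: ring A by (rule ring_weyl_alg)

lemma A_eq: "A = quot_alg free_alg (nc_ideal rels)"
  by (simp add: weyl_alg_def presented_alg_def)

lemmas ideal_rels' = ideal_presented_alg[of rels]

abbreviation cls :: "(gen, 'k) ncpoly \<Rightarrow> (gen, 'k) ncpoly set"
  where "cls \<equiv> nc_coset (nc_ideal rels)"

lemma cls_eq_iff: "cls f = cls g \<longleftrightarrow> f \<approx> g"
  by (simp add: nc_coset_eq_iff ideal_presented_alg cong_def)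

lemma A_carrier: "carrier A = range cls"
  unfolding A_eq by (rule quot_carrier) (rule ideal_presented_alg)

lemma A_ops:
  "\<one>\<^bsub>A\<^esub> = cls 1" "\<zero>\<^bsub>A\<^esub> = cls 0" "cls f \<oplus>\<^bsub>A\<^esub> cls g = cls (f + g)" "cls f \<otimes>\<^bsub>A\<^esub> cls g = cls (f * g)"
  "r \<odot>\<^bsub>A\<^esub> cls f = cls (ncconst r * f)"
  unfolding A_eq
  by (rule quot_one[OF ideal_rels'] quot_zero[OF ideal_rels'] quot_add[OF ideal_rels']
      quot_mult[OF ideal_rels'] quot_smult[OF ideal_rels'])+

text \<open>The choice of a representative is immaterial because \<open>val\<close> is constant on cosets (lemma \<open>cls_val\<close>).\<close>

definition cls_val :: "(gen, 'k) ncpoly set \<Rightarrow> exponent \<Rightarrow>\<^sub>0 'k poly"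
  where "cls_val u = val (SOME f. f \<in> u)"

lemma cls_val: "cls_val (cls f) = val f"
proof -
  have "f \<in> cls f" by (simp add: nc_coset_def ideal_rels(1))
  then have "(SOME g. g \<in> cls f) \<in> cls f" by (rule someI)
  then have "(SOME g. g \<in> cls f) \<approx> f" by (simp add: nc_coset_def cong_def)
  then show ?thesis unfolding cls_val_def by (simp add: val_eq_iff)
qed

lemma cls_val_ops:
  "cls_val \<one>\<^bsub>A\<^esub> = 1" "cls_val \<zero>\<^bsub>A\<^esub> = 0"
  "u \<in> carrier A \<Longrightarrow> v \<in> carrier A \<Longrightarrow> cls_val (u \<oplus>\<^bsub>A\<^esub> v) = cls_val u + cls_val v"
  "u \<in> carrier A \<Longrightarrow> v \<in> carrier A \<Longrightarrow> cls_val (u \<otimes>\<^bsub>A\<^esub> v) = cls_val u \<star> cls_val v"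
  "u \<in> carrier A \<Longrightarrow> cls_val (r \<odot>\<^bsub>A\<^esub> u) = scalar [:r:] \<star> cls_val u"
  unfolding A_carrier
  by (auto simp only: A_ops cls_val T.ev_one T.ev_zero T.ev_add T.ev_mult T.ev_ncconst
      tmul_one_right)

lemma cls_val_eq_iff: "u \<in> carrier A \<Longrightarrow> v \<in> carrier A \<Longrightarrow> cls_val u = cls_val v \<longleftrightarrow> u = v"
  unfolding A_carrier by (elim rangeE) (simp add: cls_val val_eq_iff cls_eq_iff)

lemma cls_val_coeff_constant: "u \<in> carrier A \<Longrightarrow> \<exists>r. lookup (cls_val u) n = [:r:]"
  by (auto simp: A_carrier cls_val val_coeff_constant)

lemma cls_val_finsum:
  assumes "\<And>i. g i \<in> carrier A"
  shows "cls_val (\<Oplus>\<^bsub>A\<^esub>i\<in>{..n::nat}. g i) = (\<Sum>i\<le>n. cls_val (g i))"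
proof (induction n)
  case (Suc n)
  then show ?case using assms by (simp add: cls_val_ops A.finsum_Suc Pi_def add.commute)
qed (simp add: assms)

definition w_power :: "nat \<Rightarrow> exponent \<Rightarrow>\<^sub>0 'k poly"
  where "w_power k = scalar (Polynomial.monom 1 k)"

text \<open>The central variable becomes the variable of the coefficient polynomials.\<close>

definition embed :: "(nat \<Rightarrow> (gen, 'k) ncpoly set) \<Rightarrow> exponent \<Rightarrow>\<^sub>0 'k poly"
  where "embed f = (\<Sum>k\<in>{k. f k \<noteq> \<zero>\<^bsub>A\<^esub>}. w_power k \<star> cls_val (f k))"

lemma B_carrier: "f \<in> carrier B \<longleftrightarrow> (\<forall>n. f n \<in> carrier A) \<and> (\<exists>N. \<forall>n\<ge>N. f n = \<zero>\<^bsub>A\<^esub>)"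
proof -
  have "(\<exists>n. bound \<zero>\<^bsub>A\<^esub> n f) \<longleftrightarrow> (\<exists>N. \<forall>n\<ge>N. f n = \<zero>\<^bsub>A\<^esub>)"
  proof
    assume "\<exists>n. bound \<zero>\<^bsub>A\<^esub> n f"
    then obtain n where "bound \<zero>\<^bsub>A\<^esub> n f" ..
    then show "\<exists>N. \<forall>n\<ge>N. f n = \<zero>\<^bsub>A\<^esub>" by (intro exI[of _ "Suc n"]) (simp add: bound_def)
  next
    assume "\<exists>N. \<forall>n\<ge>N. f n = \<zero>\<^bsub>A\<^esub>"
    then obtain N where "\<forall>n\<ge>N. f n = \<zero>\<^bsub>A\<^esub>" ..
    then show "\<exists>n. bound \<zero>\<^bsub>A\<^esub> n f" by (intro exI[of _ N]) (simp add: bound_def)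
  qed
  then show ?thesis by (simp add: poly_alg_def UP_def up_def Pi_def)
qed

lemma embed_bounded:
  assumes "\<And>n. n \<ge> N \<Longrightarrow> f n = \<zero>\<^bsub>A\<^esub>"
  shows "embed f = (\<Sum>k<N. w_power k \<star> cls_val (f k))"
  unfolding embed_def
proof (rule sum.mono_neutral_left)
  show "{k. f k \<noteq> \<zero>\<^bsub>A\<^esub>} \<subseteq> {..<N}" using assms by (auto intro: leI)
qed (auto simp: cls_val_ops)

lemma embed_add:
  assumes "f \<in> carrier B" "g \<in> carrier B"
  shows "embed (f \<oplus>\<^bsub>B\<^esub> g) = embed f + embed g"
proof -
  obtain M N where MN: "\<And>n. n \<ge> M \<Longrightarrow> f n = \<zero>\<^bsub>A\<^esub>" "\<And>n. n \<ge> N \<Longrightarrow> g n = \<zero>\<^bsub>A\<^esub>"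
    using assms by (auto simp: B_carrier)
  have c: "f n \<in> carrier A" "g n \<in> carrier A" for n using assms by (simp_all add: B_carrier)
  have fg: "f \<oplus>\<^bsub>B\<^esub> g = (\<lambda>n. f n \<oplus>\<^bsub>A\<^esub> g n)"
    using assms by (simp add: poly_alg_def UP_def)
  have "embed (f \<oplus>\<^bsub>B\<^esub> g) = (\<Sum>k<max M N. w_power k \<star> cls_val (f k \<oplus>\<^bsub>A\<^esub> g k))"
    unfolding fg by (rule embed_bounded) (simp add: MN)
  also have "\<dots> = (\<Sum>k<max M N. w_power k \<star> cls_val (f k)) + (\<Sum>k<max M N. w_power k \<star> cls_val (g k))"
    by (simp add: cls_val_ops c tmul_add_right sum.distrib)
  also have "\<dots> = embed f + embed g"
    by (simp add: embed_bounded[of "max M N"] MN)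
  finally show ?thesis .
qed

lemma w_power_mult: "w_power i \<star> w_power j = w_power (i + j)"
  by (simp add: w_power_def tmul_single mult_monom)

lemma w_power_interchange: "(w_power i \<star> u) \<star> (w_power j \<star> v) = w_power (i + j) \<star> (u \<star> v)"
proof -
  have "u \<star> (w_power j \<star> v) = w_power j \<star> (u \<star> v)"
    unfolding w_power_def by (rule tmul_scalar_left_commute)
  then show ?thesis by (simp add: tmul_assoc flip: w_power_mult)
qed

lemma embed_mult:
  assumes "f \<in> carrier B" "g \<in> carrier B"
  shows "embed (f \<otimes>\<^bsub>B\<^esub> g) = embed f \<star> embed g"
proof -
  obtain M N where MN: "\<And>n. n \<ge> M \<Longrightarrow> f n = \<zero>\<^bsub>A\<^esub>" "\<And>n. n \<ge> N \<Longrightarrow> g n = \<zero>\<^bsub>A\<^esub>"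
    using assms by (auto simp: B_carrier)
  have c: "f n \<in> carrier A" "g n \<in> carrier A" for n using assms by (simp_all add: B_carrier)
  have fg: "f \<otimes>\<^bsub>B\<^esub> g = (\<lambda>n. \<Oplus>\<^bsub>A\<^esub>i\<in>{..n}. f i \<otimes>\<^bsub>A\<^esub> g (n - i))"
    using assms by (simp add: poly_alg_def UP_def)
  define G where "G i j = (w_power i \<star> cls_val (f i)) \<star> (w_power j \<star> cls_val (g j))" for i j
  have G_zero: "G i j = 0" if "i \<ge> M \<or> j \<ge> N" for i j
    using that MN by (auto simp: G_def cls_val_ops)
  have "embed (f \<otimes>\<^bsub>B\<^esub> g) = (\<Sum>k<M + N. w_power k \<star> cls_val (\<Oplus>\<^bsub>A\<^esub>i\<in>{..k}. f i \<otimes>\<^bsub>A\<^esub> g (k - i)))"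
    unfolding fg
  proof (rule embed_bounded)
    fix n assume "M + N \<le> n"
    then have "f i \<otimes>\<^bsub>A\<^esub> g (n - i) = \<zero>\<^bsub>A\<^esub>" for i
      using MN(1)[of i] MN(2)[of "n - i"] c by (cases "i < M") auto
    then show "(\<Oplus>\<^bsub>A\<^esub>i\<in>{..n}. f i \<otimes>\<^bsub>A\<^esub> g (n - i)) = \<zero>\<^bsub>A\<^esub>" by simp
  qed
  also have "\<dots> = (\<Sum>k<M + N. \<Sum>i\<le>k. G i (k - i))"
    by (intro sum.cong refl)
      (simp add: cls_val_finsum cls_val_ops c tmul_sum_right G_def w_power_interchange)
  also have "\<dots> = (\<Sum>(i, j)\<in>{(i, j). i + j < M + N}. G i j)"
    by (rule sum.triangle_reindex[symmetric])
  also have "\<dots> = (\<Sum>(i, j)\<in>{..<M} \<times> {..<N}. G i j)"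
  proof (rule sum.mono_neutral_right)
    show "finite {(i, j). i + j < M + N}"
      by (rule finite_subset[of _ "{..<M + N} \<times> {..<M + N}"]) auto
  qed (use G_zero in \<open>auto intro: ccontr simp: not_less\<close>)
  also have "\<dots> = (\<Sum>i<M. \<Sum>j<N. G i j)"
    by (rule sum.cartesian_product[symmetric])
  also have "\<dots> = embed f \<star> embed g"
    by (simp add: embed_bounded[of M f] embed_bounded[of N g] MN tmul_sum_left tmul_sum_right G_def)
      (rule sum.swap)
  finally show ?thesis .
qed

lemma B_smult_closed:
  assumes "f \<in> carrier B"
  shows "r \<odot>\<^bsub>B\<^esub> f \<in> carrier B"
proof -
  have "r \<odot>\<^bsub>A\<^esub> \<zero>\<^bsub>A\<^esub> = \<zero>\<^bsub>A\<^esub>" by (simp add: A_ops)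
  moreover have "r \<odot>\<^bsub>A\<^esub> u \<in> carrier A" if "u \<in> carrier A" for u
    using that by (auto simp: A_carrier A_ops)
  moreover have "r \<odot>\<^bsub>B\<^esub> f = (\<lambda>n. r \<odot>\<^bsub>A\<^esub> f n)" by (simp add: poly_alg_def)
  moreover obtain N where "\<And>n. n \<ge> N \<Longrightarrow> f n = \<zero>\<^bsub>A\<^esub>" using assms by (auto simp: B_carrier)
  ultimately show ?thesis using assms by (auto simp: B_carrier intro!: exI[of _ N])
qed

lemma embed_smult:
  assumes "f \<in> carrier B"
  shows "embed (r \<odot>\<^bsub>B\<^esub> f) = scalar [:r:] \<star> embed f"
proof -
  obtain N where N: "\<And>n. n \<ge> N \<Longrightarrow> f n = \<zero>\<^bsub>A\<^esub>" using assms by (auto simp: B_carrier)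
  have c: "f n \<in> carrier A" for n using assms by (simp add: B_carrier)
  have "r \<odot>\<^bsub>B\<^esub> f = (\<lambda>n. r \<odot>\<^bsub>A\<^esub> f n)" by (simp add: poly_alg_def)
  moreover have "r \<odot>\<^bsub>A\<^esub> \<zero>\<^bsub>A\<^esub> = \<zero>\<^bsub>A\<^esub>" by (simp add: A_ops)
  ultimately have "embed (r \<odot>\<^bsub>B\<^esub> f) = (\<Sum>k<N. w_power k \<star> cls_val (r \<odot>\<^bsub>A\<^esub> f k))"
    by (simp add: embed_bounded N)
  then show ?thesis
    by (simp add: cls_val_ops c embed_bounded[of N f] N tmul_sum_right tmul_scalar_left_commute)
qed

text \<open>The values of elements of \<open>A\<close> have constant coefficients, so the powers of \<open>w\<close> separate the contributions of the
  different coefficients of \<open>f\<close>.\<close>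

lemma coeff_lookup_embed:
  assumes "f \<in> carrier B"
  shows "Polynomial.coeff (lookup (embed f) n) k = Polynomial.coeff (lookup (cls_val (f k)) n) 0"
proof -
  obtain N where N: "\<And>n. n \<ge> N \<Longrightarrow> f n = \<zero>\<^bsub>A\<^esub>" using assms by (auto simp: B_carrier)
  have coeff: "Polynomial.coeff (lookup (w_power j \<star> cls_val (f j)) n) k
      = (if j = k then Polynomial.coeff (lookup (cls_val (f k)) n) 0 else 0)" for j
  proof -
    have "f j \<in> carrier A" using assms by (simp add: B_carrier)
    then obtain r where "lookup (cls_val (f j)) n = [:r:]" using cls_val_coeff_constant by blast
    then show ?thesis by (auto simp: w_power_def)
  qed
  have "embed f = (\<Sum>j<max N (Suc k). w_power j \<star> cls_val (f j))"
    by (rule embed_bounded) (simp add: N)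
  then show ?thesis by (simp add: lookup_sum Polynomial.coeff_sum coeff)
qed

lemma inj_on_embed: "inj_on embed (carrier B)"
proof (rule inj_onI, rule ext)
  fix f g k assume f: "f \<in> carrier B" and g: "g \<in> carrier B" and eq: "embed f = embed g"
  have c: "f k \<in> carrier A" "g k \<in> carrier A" using f g by (simp_all add: B_carrier)
  have "lookup (cls_val (f k)) n = lookup (cls_val (g k)) n" for n
  proof -
    obtain a b where ab: "lookup (cls_val (f k)) n = [:a:]" "lookup (cls_val (g k)) n = [:b:]"
      using cls_val_coeff_constant[OF c(1)] cls_val_coeff_constant[OF c(2)] by blast
    then have "a = b"
      using coeff_lookup_embed[OF f, of n k] coeff_lookup_embed[OF g, of n k] eq by simp
    with ab show ?thesis by simp
  qed
  then have "cls_val (f k) = cls_val (g k)" by (rule poly_mapping_eqI)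
  then show "f k = g k" using cls_val_eq_iff[OF c] by simp
qed

definition img :: "(exponent \<Rightarrow>\<^sub>0 'k poly) set"
  where "img = embed ` carrier B"

lemma ring_B: "ring B" by (rule ring_poly_alg) (rule ring_weyl_alg)

lemma img_add: "u \<in> img \<Longrightarrow> v \<in> img \<Longrightarrow> u + v \<in> img"
  using ring.ring_simprules(1)[OF ring_B] by (auto simp: img_def simp flip: embed_add)

lemma img_mult: "u \<in> img \<Longrightarrow> v \<in> img \<Longrightarrow> u \<star> v \<in> img"
  using ring.ring_simprules(5)[OF ring_B] by (auto simp: img_def simp flip: embed_mult)

lemma img_scaled_val: "scalar r \<star> val g \<in> img"
proof -
  define f where "f n = cls (ncconst (Polynomial.coeff r n) * g)" for n
  have f: "f n = \<zero>\<^bsub>A\<^esub>" if "n \<ge> Suc (Polynomial.degree r)" for n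
    using that by (simp add: f_def A_ops Polynomial.coeff_eq_0 ncconst_def)
  then have "f \<in> carrier B" by (auto simp: B_carrier A_carrier f_def[abs_def] intro!: exI[of _ "Suc (Polynomial.degree r)"])
  moreover have "embed f = scalar r \<star> val g"
  proof -
    have "embed f = (\<Sum>k<Suc (Polynomial.degree r). w_power k \<star> (scalar [:Polynomial.coeff r k:] \<star> val g))"
      by (subst embed_bounded[OF f]) (simp_all only: f_def cls_val T.ev_scaled)
    also have "\<dots> = (\<Sum>k\<le>Polynomial.degree r. scalar (Polynomial.monom (Polynomial.coeff r k) k)) \<star> val g"
      unfolding tmul_sum_left lessThan_Suc_atMost
      by (simp add: w_power_def tmul_single smult_monom flip: tmul_assoc)
    also have "(\<Sum>k\<le>Polynomial.degree r. scalar (Polynomial.monom (Polynomial.coeff r k) k)) = scalar r"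
    proof -
      have "(\<Sum>k\<in>K. scalar (h k)) = scalar (\<Sum>k\<in>K. h k)" for K :: "nat set" and h
        by (induction K rule: infinite_finite_induct) (simp_all add: single_add)
      then show ?thesis by (simp add: poly_as_sum_of_monoms)
    qed
    finally show ?thesis .
  qed
  ultimately show ?thesis unfolding img_def by (metis imageI)
qed

text \<open>Since the ordered monomials span \<open>A\<close>, the image consists of the \<open>K[w]\<close>-linear combinations of their values.\<close>

lemma img_induct [consumes 1, case_names pbw add]:
  assumes "u \<in> img"
    and pbw: "\<And>r k. P (scalar r \<star> val (pbw k))" and add: "\<And>u v. P u \<Longrightarrow> P v \<Longrightarrow> P (u + v)"
  shows "P u"
proof -
  have zero: "P 0" using pbw[of 0] by simp
  have comb: "P (scalar r \<star> val (comb F))" for r F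
  proof (induction F rule: poly_mapping_additive_induct)
    case (single k c)
    show ?case using pbw[of "r * [:c:]" k]
      by (simp add: comb_single T.ev_scaled tmul_single flip: tmul_assoc)
  qed (simp add: comb_add T.ev_simps tmul_add_right add)
  have val: "P (scalar r \<star> val f)" for r f
  proof -
    obtain F where "f \<approx> comb F" using spanned_all spanned_def by blast
    then have "val f = val (comb F)" by (simp add: val_eq_iff)
    then show ?thesis using comb by simp
  qed
  obtain f where f: "f \<in> carrier B" and u: "u = embed f" using assms(1) by (auto simp: img_def)
  have "P (w_power k \<star> cls_val (f k))" for k
    using f val by (auto simp: B_carrier A_carrier cls_val w_power_def elim: allE[of _ k])
  then have "P (\<Sum>k\<in>K. w_power k \<star> cls_val (f k))" for K
    by (induction K rule: infinite_finite_induct) (simp_all add: zero add)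
  then show ?thesis unfolding u embed_def .
qed

section \<open>Normal elements\<close>

lemmas p_power_inject [simp] = power_int_eq_iff_generic[OF p_nonzero p_generic]
lemmas q_power_inject [simp] = power_int_eq_iff_generic[OF q_nonzero q_generic]

lemma p_power_eq_one [simp]: "p powi i = 1 \<longleftrightarrow> i = 0"
  using p_power_inject[of i 0] by simp

lemma q_power_eq_one [simp]: "q powi i = 1 \<longleftrightarrow> i = 0"
  using q_power_inject[of i 0] by simp

lemma p_power_nat_eq_one [simp]: "p ^ d = 1 \<longleftrightarrow> d = 0"
  using p_power_eq_one[of "int d"] by simp

lemma gen_in_img: "gen_val g \<in> img"
  using img_scaled_val[of 1 "ncvar g"] by (simp add: T.ev_ncvar)

lemma generators_in_img: "X \<in> img" "Y \<in> img" "S \<in> img" "T \<in> img"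
  using gen_in_img[of Gen_x] gen_in_img[of Gen_y] gen_in_img[of Gen_s] gen_in_img[of Gen_t] by simp_all

lemma scalar_in_img: "scalar r \<in> img"
  using img_scaled_val[of r 1] by (simp add: T.ev_one)

lemma Z_eq: "Z = 1 + scalar [:p - 1:] \<star> (Y \<star> X)"
proof -
  have "scalar [:p - 1:] \<star> (Y \<star> X) = Z - 1"
    by (simp add: Y_def tmul_diff_left tmul_diff_right tmul_single cocycle_tuple zero_exponent flip: one_pCons)
  then show ?thesis by simp
qed

lemma Z_in_img: "Z \<in> img"
  unfolding Z_eq using scalar_in_img[of 1] by (intro img_add img_mult scalar_in_img generators_in_img) simp

lemma img_keys_nonneg:
  assumes "u \<in> img" "(i, d, a, b) \<in> keys u"
  shows "0 \<le> d \<and> 0 \<le> a \<and> 0 \<le> b"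
  using assms
proof (induction u rule: img_induct)
  case (pbw r k)
  obtain j i' a' b' where k: "k = (j, i', a', b')" by (cases k)
  from pbw have "(i, d, a, b) \<in> keys (val (pbw k))" by (auto simp: in_keys_iff)
  then show ?case using keys_val_pbw[of "(i, d, a, b)" j i' a' b'] k by auto
next
  case (add u v)
  then show ?case using keys_add[of u v] by blast
qed

text \<open>The part of \<open>x\<close>-degree \<open>- 1\<close> and degree \<open>0\<close> in \<open>s\<close> and \<open>t\<close>, evaluated at \<open>z = 1\<close>. It vanishes on everything that
  has \<open>y\<close>, and hence \<open>z - 1\<close>, as a left factor. This is the obstruction to \<open>x\<^sup>-\<^sup>1\<close> lying in the image.\<close>

definition residue :: "(exponent \<Rightarrow>\<^sub>0 'k poly) \<Rightarrow> 'k poly"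
  where "residue = additive_ext (\<lambda>(i, d, a, b) r. if i = - 1 \<and> a = 0 \<and> b = 0 then r else 0)"

lemma residue_add: "residue (u + v) = residue u + residue v"
  unfolding residue_def by (rule additive_ext_add) auto

lemma residue_single:
  "residue (single (i, d, a, b) r) = (if i = - 1 \<and> a = 0 \<and> b = 0 then r else 0)"
  unfolding residue_def by (subst additive_ext_single) auto

lemma residue_diff: "residue (u - v) = residue u - residue v"
  using residue_add[of "u - v" v] by (simp add: eq_diff_eq)

lemma residue_Y_tmul: "residue (Y \<star> v) = 0"
proof (induction v rule: poly_mapping_additive_induct)
  case (single n r)
  obtain i d a b where "n = (i, d, a, b)" by (cases n)
  then show ?case
    by (simp add: Y_def tmul_diff_left tmul_single residue_diff residue_single cocycle_tuple)
qed (simp add: tmul_add_right residue_add)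

text \<open>An ordered monomial either has \<open>y\<close> as a left factor or has nonnegative \<open>x\<close>-degree.\<close>

lemma residue_img:
  assumes "u \<in> img"
  shows "residue u = 0"
  using assms
proof (induction u rule: img_induct)
  case (pbw r k)
  obtain j i a b where k: "k = (j, i, a, b)" by (cases k)
  show ?case
  proof (cases j)
    case 0
    have "val (pbw k) = single (int i, 0, int a, int b) 1"
      by (simp add: k 0 val_pbw T.ev_one)
    then show ?thesis by (simp add: tmul_single residue_single)
  next
    case (Suc j')
    have "scalar r \<star> val (pbw k) = Y \<star> (scalar r \<star> (val (y\<^sub>f ^ j') \<star> single (int i, 0, int a, int b) 1))"
      by (simp add: k Suc val_pbw T.ev_mult T.ev_ncvar tmul_assoc tmul_scalar_left_commute[of Y])
    then show ?thesis by (simp add: residue_Y_tmul)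
  qed
qed (simp add: residue_add)

text \<open>The inclusion \<open>u B \<subseteq> B u\<close>, where \<open>B\<close> is identified with its image.\<close>

definition normal :: "(exponent \<Rightarrow>\<^sub>0 'k poly) \<Rightarrow> bool"
  where "normal u \<longleftrightarrow> u \<in> img \<and> u \<noteq> 0 \<and> (\<forall>v\<in>img. \<exists>v'\<in>img. u \<star> v = v' \<star> u)"

text \<open>Conjugation by \<open>u\<close> multiplies the monomial \<open>X\<^sup>e\<close> by a scalar. This scalar is the commutation factor of \<open>X\<^sup>e\<close> with
  each exponent of \<open>u\<close>, so these factors agree. The statement is a cross-multiplied form of the equality of the
  quotients \<open>c(n, e) / c(e, n)\<close>.\<close>

lemma normal_cocycle:
  assumes "normal u" and e: "single e 1 \<in> img" and n: "n \<in> keys u" and n': "n' \<in> keys u"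
  shows "cocycle n e * cocycle e n' = cocycle n' e * cocycle e n"
proof -
  obtain v where eq: "u \<star> single e 1 = v \<star> u" using assms(1) e by (auto simp: normal_def)
  moreover have "u \<noteq> 0" using assms(1) by (simp add: normal_def)
  ultimately obtain k where "v = single e k" "k \<noteq> 0" by (rule tmul_eq_single_tmul) simp_all
  then have same: "lookup (u \<star> single e 1) (n + e) = lookup (single e k \<star> u) (n + e)" for n
    using eq by simp
  have k: "cocycle n e = k * cocycle e n" if "n \<in> keys u" for n
  proof -
    have "lookup u n * cocycle n e = lookup u n * (k * cocycle e n)"
      using same[of n] by (simp add: lookup_tmul_single_left lookup_tmul_single_right mult_ac)
    then show ?thesis using that mult_left_cancel by (auto simp only: in_keys_iff)
  qed
  show ?thesis using k[OF n] k[OF n'] by (simp add: mult_ac)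
qed

text \<open>The commutation factors with \<open>z, s, t, x\<close> determine, in this order, the exponents of \<open>x\<close>, \<open>t\<close>, \<open>s\<close>, \<open>z\<close>, so \<open>u\<close> is a
  monomial. Conjugation by \<open>u\<close> then maps \<open>(z - 1)x\<^sup>-\<^sup>1\<close> to a multiple of \<open>(p\<^sup>i z - 1)x\<^sup>-\<^sup>1\<close>, whose residue is a nonzero
  multiple of \<open>p\<^sup>i - 1\<close>; it must vanish because the image of \<open>y\<close> lies in the algebra again.\<close>

lemma normal_single:
  assumes u: "normal u"
  obtains d a b f where "u = single (0, int d, int a, int b) f" "f \<noteq> 0"
proof -
  have nz: "u \<noteq> 0" and img: "u \<in> img" using u by (simp_all add: normal_def)
  then obtain n where n: "n \<in> keys u" by (auto simp: poly_mapping_eq_iff fun_eq_iff in_keys_iff)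
  obtain i d a b where n_eq: "n = (i, d, a, b)" by (cases n)
  have unique: "n' = n" if n': "n' \<in> keys u" for n'
  proof -
    obtain i' d' a' b' where n'_eq: "n' = (i', d', a', b')" by (cases n')
    note c = normal_cocycle[OF u _ n n', unfolded n_eq n'_eq cocycle_tuple]
    have "i = i'" using c[OF Z_in_img] by (simp add: cocycle_tuple)
    moreover from this have "b = b'" using c[OF generators_in_img(3)] by (simp add: cocycle_tuple)
    moreover from \<open>i = i'\<close> have "a = a'" using c[OF generators_in_img(4)] by (simp add: cocycle_tuple)
    moreover from \<open>a = a'\<close> \<open>b = b'\<close> have "d = d'"
      using c[OF generators_in_img(1)] by (simp add: cocycle_tuple)
    ultimately show ?thesis by (simp add: n_eq n'_eq)
  qed
  have keys_u: "lookup u k = 0" if "k \<noteq> n" for k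
    using that unique[of k] unfolding in_keys_iff by blast
  define f where "f = lookup u n"
  have f: "f \<noteq> 0" using n by (simp add: f_def in_keys_iff)
  have u_eq: "u = single n f"
    by (rule poly_mapping_eqI) (simp add: f_def lookup_single when_def keys_u)
  obtain v where v: "v \<in> img" "u \<star> Y = v \<star> u" using u generators_in_img by (auto simp: normal_def)
  \<comment> \<open>\<open>v\<close> is the conjugate of \<open>y\<close> by \<open>u\<close>\<close>
  have lv: "lookup v k * cocycle k n = lookup Y k * cocycle n k" for k
  proof -
    have "f * (lookup v k * cocycle k n) = lookup (v \<star> u) (n + k)"
      unfolding u_eq by (simp add: lookup_tmul_single_right mult_ac)
    also have "\<dots> = lookup (u \<star> Y) (n + k)" by (simp add: v)
    also have "\<dots> = f * (lookup Y k * cocycle n k)"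
      unfolding u_eq by (simp add: lookup_tmul_single_left mult_ac)
    finally show ?thesis using f by simp
  qed
  let ?k\<^sub>1 = "(-1, 1, 0, 0) :: exponent" and ?k\<^sub>2 = "(-1, 0, 0, 0) :: exponent"
  have Y_lookup: "lookup Y ?k\<^sub>1 = [:1 / (p - 1):]" "lookup Y ?k\<^sub>2 = - [:1 / (p - 1):]"
    "k \<noteq> ?k\<^sub>1 \<Longrightarrow> k \<noteq> ?k\<^sub>2 \<Longrightarrow> lookup Y k = 0" for k
    by (simp_all add: Y_def lookup_minus lookup_single when_def)
  have "lookup v k = 0" if "k \<noteq> ?k\<^sub>1" "k \<noteq> ?k\<^sub>2" for k
    using lv[of k] Y_lookup(3)[OF that] by simp
  then have "v = single ?k\<^sub>1 (lookup v ?k\<^sub>1) + single ?k\<^sub>2 (lookup v ?k\<^sub>2)"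
    by (intro poly_mapping_eqI) (auto simp: lookup_add lookup_single when_def)
  from arg_cong[OF this, of residue] have "residue v = lookup v ?k\<^sub>1 + lookup v ?k\<^sub>2"
    by (simp only: residue_add residue_single) simp
  then have "(lookup v ?k\<^sub>1 + lookup v ?k\<^sub>2) * cocycle ?k\<^sub>1 n = 0" using residue_img[OF v(1)] by simp
  moreover have "cocycle ?k\<^sub>1 n = cocycle ?k\<^sub>2 n" by (simp add: n_eq cocycle_tuple)
  ultimately have "lookup v ?k\<^sub>1 * cocycle ?k\<^sub>1 n + lookup v ?k\<^sub>2 * cocycle ?k\<^sub>2 n = 0"
    by (simp only: distrib_right)
  moreover have factor: "c * (r * r') + - c * r' = c * r' * (r - 1)" for c r r' :: "'k poly"
    by (simp add: algebra_simps)
  moreover have "cocycle n ?k\<^sub>1 = [:p powi i:] * cocycle n ?k\<^sub>2" by (simp add: n_eq cocycle_tuple)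
  ultimately have "[:1 / (p - 1):] * cocycle n ?k\<^sub>2 * ([:p powi i:] - 1) = 0"
    unfolding lv Y_lookup by (simp only: factor)
  then have "[:p powi i:] = 1" by simp
  then have "i = 0" by (simp only: one_pCons pCons_eq_iff p_power_eq_one)
  moreover have "0 \<le> d" "0 \<le> a" "0 \<le> b"
    using img_keys_nonneg[OF img, of i d a b] n by (simp_all add: n_eq)
  ultimately show ?thesis using that[of "nat d" "nat a" "nat b" f] f u_eq n_eq by simp
qed

lemma normal_central_scalar:
  assumes "normal u" and central: "\<And>v. v \<in> img \<Longrightarrow> u \<star> v = v \<star> u"
  obtains f where "u = scalar f" "f \<noteq> 0"
proof -
  obtain d a b f where u: "u = single (0, int d, int a, int b) f" "f \<noteq> 0"
    using normal_single[OF assms(1)] .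
  have c: "cocycle (0, int d, int a, int b) e = cocycle e (0, int d, int a, int b)" if "single e 1 \<in> img" for e
  proof -
    have "single (0, int d, int a, int b) f \<star> single e 1 = scalar 1 \<star> (single e 1 \<star> single (0, int d, int a, int b) f)"
      using central[OF that] by (simp add: u)
    then show ?thesis using skew_commute_keys[of _ f "single e 1" 1 e] u(2) by simp
  qed
  have "b = 0" using c[OF generators_in_img(3)] by (simp add: cocycle_tuple)
  moreover have "a = 0" using c[OF generators_in_img(4)] by (simp add: cocycle_tuple)
  moreover have "d = 0" using c[OF generators_in_img(1)] calculation by (simp add: cocycle_tuple)
  ultimately show ?thesis using that u by (simp add: zero_exponent)
qed

text \<open>A monomial is normal if it commutes with each ordered monomial up to a scalar; the scalar may depend on the
  ordered monomial, but not on the exponents that occur in its value.\<close>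

lemma normalI_skew:
  assumes "single e 1 \<in> img"
    and "\<And>j i a b. \<exists>k. \<forall>n\<in>keys (val (pbw (j, i, a, b))). cocycle e n = [:k:] * cocycle n e"
  shows "normal (single e 1)"
proof -
  have "\<exists>v'\<in>img. single e 1 \<star> v = v' \<star> single e 1" if "v \<in> img" for v
    using that
  proof (induction v rule: img_induct)
    case (pbw r k)
    obtain j i a b where k: "k = (j, i, a, b)" by (cases k)
    obtain h where "\<forall>n\<in>keys (val (pbw k)). cocycle e n = [:h:] * cocycle n e"
      using assms(2)[of j i a b] unfolding k by blast
    then have h: "single e 1 \<star> val (pbw k) = scalar [:h:] \<star> (val (pbw k) \<star> single e 1)"
      by (intro skew_commuteI) blast
    have "single e 1 \<star> (scalar r \<star> val (pbw k)) = scalar r \<star> (single e 1 \<star> val (pbw k))"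
      by (rule tmul_scalar_left_commute)
    also have "\<dots> = (scalar r \<star> (scalar [:h:] \<star> val (pbw k))) \<star> single e 1"
      unfolding h by (simp only: tmul_assoc)
    finally have "single e 1 \<star> (scalar r \<star> val (pbw k)) = (scalar r \<star> (scalar [:h:] \<star> val (pbw k))) \<star> single e 1" .
    moreover have "scalar r \<star> (scalar [:h:] \<star> val (pbw k)) \<in> img"
      by (rule img_mult[OF scalar_in_img img_scaled_val])
    ultimately show ?case by blast
  next
    case (add u v)
    then obtain u' v' where "u' \<in> img" "single e 1 \<star> u = u' \<star> single e 1"
      "v' \<in> img" "single e 1 \<star> v = v' \<star> single e 1" by blast
    then have "u' + v' \<in> img" "single e 1 \<star> (u + v) = (u' + v') \<star> single e 1"
      by (simp_all add: img_add tmul_add_left tmul_add_right)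
    then show ?case by blast
  qed
  then show ?thesis using assms(1) by (simp add: normal_def single_eq_zero_iff)
qed

lemma normal_Z: "normal Z"
proof (rule normalI_skew[OF Z_in_img])
  show "\<exists>k. \<forall>n\<in>keys (val (pbw (j, i, a, b))). cocycle (0, 1, 0, 0) n = [:k:] * cocycle n (0, 1, 0, 0)"
    for j i a b
    by (intro exI[of _ "p powi (int j - int i)"] ballI)
      (auto dest!: keys_val_pbw simp: cocycle_tuple simp flip: power_int_add)
qed

lemma normal_S: "normal S"
proof (rule normalI_skew[OF generators_in_img(3)])
  show "\<exists>k. \<forall>n\<in>keys (val (pbw (j, i, a, b))). cocycle (0, 0, 1, 0) n = [:k:] * cocycle n (0, 0, 1, 0)"
    for j i a b
    by (intro exI[of _ "l powi (int i - int j) * q powi int b"] ballI)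
      (auto dest!: keys_val_pbw simp: cocycle_tuple power_int_minus)
qed

lemma normal_T: "normal T"
proof (rule normalI_skew[OF generators_in_img(4)])
  show "\<exists>k. \<forall>n\<in>keys (val (pbw (j, i, a, b))). cocycle (0, 0, 0, 1) n = [:k:] * cocycle n (0, 0, 0, 1)"
    for j i a b
    by (intro exI[of _ "m powi (int i - int j) * q powi (- int a)"] ballI)
      (auto dest!: keys_val_pbw simp: cocycle_tuple)
qed

lemma normal_scalar: "r \<noteq> 0 \<Longrightarrow> normal (scalar r)"
  using scalar_in_img[of r] unfolding normal_def by (metis single_eq_zero_iff tmul_scalar_central)

text \<open>With \<open>z\<close> and \<open>s\<close> on the left and \<open>t\<close> on the right no factors appear, since the \<open>x\<close>-degree is zero.\<close>

lemma monomial_recursion: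
  "single (0, int (Suc d), int a, int b) f = Z \<star> single (0, int d, int a, int b) f"
  "single (0, int d, int (Suc a), int b) f = S \<star> single (0, int d, int a, int b) f"
  "single (0, int d, int a, int (Suc b)) f = single (0, int d, int a, int b) f \<star> T"
  by (simp_all add: tmul_single cocycle_tuple add.commute)

lemma monomial_in_img: "single (0, int d, int a, int b) f \<in> img"
proof -
  have "single (0, int 0, int 0, int b) f \<in> img"
  proof (induction b)
    case 0
    then show ?case using scalar_in_img by (simp add: zero_exponent)
  next
    case (Suc b)
    then show ?case by (subst monomial_recursion) (intro img_mult generators_in_img)
  qed
  then have "single (0, int 0, int a, int b) f \<in> img"
    by (induction a) (simp, subst monomial_recursion, intro img_mult generators_in_img)
  then show ?thesis
    by (induction d) (simp, subst monomial_recursion, intro img_mult Z_in_img)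
qed

end

section \<open>Isomorphisms and the parameters\<close>

text \<open>The exponents of a monomial \<open>f(w) z\<^sup>d s\<^sup>a t\<^sup>b\<close>.\<close>

definition has_degree :: "(exponent \<Rightarrow>\<^sub>0 'k::field poly) \<Rightarrow> nat \<Rightarrow> nat \<Rightarrow> nat \<Rightarrow> bool"
  where "has_degree u d a b \<longleftrightarrow> (\<exists>f. f \<noteq> 0 \<and> u = single (0, int d, int a, int b) f)"

lemma has_degree_unique:
  assumes "has_degree u d a b" "has_degree u d' a' b'"
  shows "d = d' \<and> a = a' \<and> b = b'"
proof -
  have "keys u = {(0, int d, int a, int b)}" using assms(1) by (auto simp: has_degree_def)
  moreover have "keys u = {(0, int d', int a', int b')}" using assms(2) by (auto simp: has_degree_def)
  ultimately show ?thesis by simp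
qed

lemma (in weyl_parameters) has_degree_mult:
  assumes "has_degree u d a b" "has_degree v d' a' b'"
  shows "has_degree (u \<star> v) (d + d') (a + a') (b + b')"
proof -
  obtain f g where "f \<noteq> 0" "u = single (0, int d, int a, int b) f"
    "g \<noteq> 0" "v = single (0, int d', int a', int b') g"
    using assms by (auto simp: has_degree_def)
  then show ?thesis
    by (auto simp: has_degree_def tmul_single intro!: exI[of _ "f * g * cocycle _ _"])
qed

lemma (in weyl_parameters) normal_has_degree: "normal u \<Longrightarrow> \<exists>d a b. has_degree u d a b"
  by (elim normal_single) (auto simp: has_degree_def)

lemma nat_matrix_inverse_cases:
  fixes a b c d a' b' c' d' :: nat
  assumes "a * a' + b * c' = 1" "a * b' + b * d' = 0" "c * a' + d * c' = 0" "c * b' + d * d' = 1"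
  shows "a = 1 \<and> b = 0 \<and> c = 0 \<and> d = 1 \<or> a = 0 \<and> b = 1 \<and> c = 1 \<and> d = 0"
  using assms by (auto simp: add_is_1)

text \<open>An isomorphism between two of the polynomial extensions, seen through their embeddings.\<close>

locale weyl_isomorphism =
  W\<^sub>1: weyl_parameters p\<^sub>1 l\<^sub>1 m\<^sub>1 q\<^sub>1 + W\<^sub>2: weyl_parameters p\<^sub>2 l\<^sub>2 m\<^sub>2 q\<^sub>2
  for p\<^sub>1 l\<^sub>1 m\<^sub>1 q\<^sub>1 p\<^sub>2 l\<^sub>2 m\<^sub>2 q\<^sub>2 :: "'k::field" +
  fixes \<psi> :: "(exponent \<Rightarrow>\<^sub>0 'k poly) \<Rightarrow> (exponent \<Rightarrow>\<^sub>0 'k poly)"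
  assumes bij: "bij_betw \<psi> W\<^sub>1.img W\<^sub>2.img"
    and mult: "u \<in> W\<^sub>1.img \<Longrightarrow> v \<in> W\<^sub>1.img \<Longrightarrow> \<psi> (W\<^sub>1.tmul u v) = W\<^sub>2.tmul (\<psi> u) (\<psi> v)"
    and smult: "u \<in> W\<^sub>1.img \<Longrightarrow> \<psi> (W\<^sub>1.tmul (single 0 [:r:]) u) = W\<^sub>2.tmul (single 0 [:r:]) (\<psi> u)"
begin

lemma inverse_isomorphism:
  "weyl_isomorphism p\<^sub>2 l\<^sub>2 m\<^sub>2 q\<^sub>2 p\<^sub>1 l\<^sub>1 m\<^sub>1 q\<^sub>1 (inv_into W\<^sub>1.img \<psi>)"
proof
  let ?\<phi> = "inv_into W\<^sub>1.img \<psi>"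
  show bij': "bij_betw ?\<phi> W\<^sub>2.img W\<^sub>1.img" by (rule bij_betw_inv_into[OF bij])
  have mem: "?\<phi> u \<in> W\<^sub>1.img" if "u \<in> W\<^sub>2.img" for u using bij' that by (rule bij_betwE[rule_format])
  have right: "\<psi> (?\<phi> u) = u" if "u \<in> W\<^sub>2.img" for u by (rule bij_betw_inv_into_right[OF bij that])
  have left: "?\<phi> (\<psi> u) = u" if "u \<in> W\<^sub>1.img" for u by (rule bij_betw_inv_into_left[OF bij that])
  show "?\<phi> (W\<^sub>2.tmul u v) = W\<^sub>1.tmul (?\<phi> u) (?\<phi> v)" if "u \<in> W\<^sub>2.img" "v \<in> W\<^sub>2.img" for u v
    using left[of "W\<^sub>1.tmul (?\<phi> u) (?\<phi> v)"] that by (simp add: mult mem right W\<^sub>1.img_mult)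
  show "?\<phi> (W\<^sub>2.tmul (single 0 [:r:]) u) = W\<^sub>1.tmul (single 0 [:r:]) (?\<phi> u)" if "u \<in> W\<^sub>2.img" for r u
    using left[of "W\<^sub>1.tmul (single 0 [:r:]) (?\<phi> u)"] that
    by (simp add: smult mem right W\<^sub>1.img_mult W\<^sub>1.scalar_in_img)
qed

lemma psi_in_img: "u \<in> W\<^sub>1.img \<Longrightarrow> \<psi> u \<in> W\<^sub>2.img"
  using bij by (rule bij_betwE[rule_format])

lemma psi_nonzero:
  assumes "u \<in> W\<^sub>1.img" "u \<noteq> 0"
  shows "\<psi> u \<noteq> 0"
proof -
  have zero: "0 \<in> W\<^sub>1.img" using W\<^sub>1.scalar_in_img[of 0] by simp
  have "\<psi> 0 = 0" using smult[OF zero, of 0] by simp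
  then show ?thesis using assms zero bij by (metis bij_betw_inv_into_left)
qed

lemma psi_surj: "v \<in> W\<^sub>2.img \<Longrightarrow> \<exists>u\<in>W\<^sub>1.img. v = \<psi> u"
  using bij by (auto simp: bij_betw_def)

lemma normal_psi:
  assumes "W\<^sub>1.normal u"
  shows "W\<^sub>2.normal (\<psi> u)"
  unfolding W\<^sub>2.normal_def
proof (intro conjI ballI)
  have u: "u \<in> W\<^sub>1.img" "u \<noteq> 0" using assms by (simp_all add: W\<^sub>1.normal_def)
  then show "\<psi> u \<in> W\<^sub>2.img" "\<psi> u \<noteq> 0" by (simp_all add: psi_in_img psi_nonzero)
  fix v assume "v \<in> W\<^sub>2.img"
  then obtain w where w: "w \<in> W\<^sub>1.img" "v = \<psi> w" using psi_surj by blast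
  obtain w' where w': "w' \<in> W\<^sub>1.img" "W\<^sub>1.tmul u w = W\<^sub>1.tmul w' u"
    using assms w(1) by (auto simp: W\<^sub>1.normal_def)
  then have "W\<^sub>2.tmul (\<psi> u) v = W\<^sub>2.tmul (\<psi> w') (\<psi> u)"
    using u w by (simp flip: mult)
  then show "\<exists>v'\<in>W\<^sub>2.img. W\<^sub>2.tmul (\<psi> u) v = W\<^sub>2.tmul v' (\<psi> u)"
    using psi_in_img[OF w'(1)] by blast
qed

text \<open>A nonzero element of \<open>K[w]\<close> is normal and central, and both properties are preserved.\<close>

lemma psi_scalar:
  assumes "f \<noteq> 0"
  shows "has_degree (\<psi> (single 0 f)) 0 0 0"
proof -
  have img: "single 0 f \<in> W\<^sub>1.img" by (rule W\<^sub>1.scalar_in_img)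
  have "W\<^sub>2.normal (\<psi> (single 0 f))" by (rule normal_psi) (rule W\<^sub>1.normal_scalar[OF assms])
  moreover have "W\<^sub>2.tmul (\<psi> (single 0 f)) v = W\<^sub>2.tmul v (\<psi> (single 0 f))" if v: "v \<in> W\<^sub>2.img" for v
  proof -
    obtain w where "w \<in> W\<^sub>1.img" "v = \<psi> w" using psi_surj[OF v] by blast
    then show ?thesis using mult[OF img, of w] mult[OF _ img, of w] W\<^sub>1.tmul_scalar_central[of w f] by simp
  qed
  ultimately obtain g where "\<psi> (single 0 f) = single 0 g" "g \<noteq> 0"
    by (rule W\<^sub>2.normal_central_scalar)
  then show ?thesis by (auto simp: has_degree_def zero_exponent)
qed

text \<open>On normal elements an isomorphism acts as a homomorphism of monoids, so on degrees it acts as the matrix whose rows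
  are the degrees of the images of \<open>z, s, t\<close>.\<close>

lemma psi_has_degree:
  assumes z: "has_degree (\<psi> W\<^sub>1.Z) zd za zb" and s: "has_degree (\<psi> W\<^sub>1.S) sd sa sb"
    and t: "has_degree (\<psi> W\<^sub>1.T) td ta tb" and u: "has_degree u d a b"
  shows "has_degree (\<psi> u) (d * zd + a * sd + b * td) (d * za + a * sa + b * ta) (d * zb + a * sb + b * tb)"
proof -
  obtain f where f: "f \<noteq> 0" and u: "u = single (0, int d, int a, int b) f"
    using u by (auto simp: has_degree_def)
  let ?u = "\<lambda>d a b. single (0, int d, int a, int b) f"
  note img = W\<^sub>1.monomial_in_img W\<^sub>1.Z_in_img W\<^sub>1.generators_in_img
  have "has_degree (\<psi> (?u 0 0 b)) (b * td) (b * ta) (b * tb)"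
  proof (induction b)
    case 0
    show ?case using psi_scalar[OF f] by (simp add: zero_exponent)
  next
    case (Suc b)
    have "\<psi> (?u 0 0 (Suc b)) = W\<^sub>2.tmul (\<psi> (?u 0 0 b)) (\<psi> W\<^sub>1.T)"
      unfolding W\<^sub>1.monomial_recursion by (intro mult img)
    then show ?case using W\<^sub>2.has_degree_mult[OF Suc t] by (simp add: add.commute)
  qed
  then have "has_degree (\<psi> (?u 0 a b)) (a * sd + b * td) (a * sa + b * ta) (a * sb + b * tb)"
  proof (induction a)
    case (Suc a)
    have "\<psi> (?u 0 (Suc a) b) = W\<^sub>2.tmul (\<psi> W\<^sub>1.S) (\<psi> (?u 0 a b))"
      unfolding W\<^sub>1.monomial_recursion by (intro mult img)
    then show ?case using W\<^sub>2.has_degree_mult[OF s Suc.IH[OF Suc.prems]] by (simp add: add.assoc)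
  qed simp
  then show ?thesis unfolding u
  proof (induction d)
    case (Suc d)
    have "\<psi> (?u (Suc d) a b) = W\<^sub>2.tmul (\<psi> W\<^sub>1.Z) (\<psi> (?u d a b))"
      unfolding W\<^sub>1.monomial_recursion by (intro mult img)
    then show ?case using W\<^sub>2.has_degree_mult[OF z Suc.IH[OF Suc.prems]] by (simp add: add.assoc)
  qed simp
qed

text \<open>Each relation \<open>gu = kug\<close> with a monomial \<open>g\<close> is transported by \<open>\<psi>\<close>; when \<open>\<psi>(g)\<close> is again a monomial, it becomes an
  equation in the parameters for each exponent of \<open>\<psi>(u)\<close>.\<close>

lemma skew_commute_psi:
  assumes e: "single e 1 \<in> W\<^sub>1.img" and u: "u \<in> W\<^sub>1.img"
    and k: "\<And>n. n \<in> keys u \<Longrightarrow> W\<^sub>1.cocycle e n = [:k:] * W\<^sub>1.cocycle n e"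
    and \<psi>: "\<psi> (single e 1) = single e' f" "f \<noteq> 0" and n: "n \<in> keys (\<psi> u)"
  shows "W\<^sub>2.cocycle e' n = [:k:] * W\<^sub>2.cocycle n e'"
proof -
  have "W\<^sub>1.tmul (single e 1) u = W\<^sub>1.tmul (single 0 [:k:]) (W\<^sub>1.tmul u (single e 1))"
    by (rule W\<^sub>1.skew_commuteI) (rule k)
  then have "W\<^sub>2.tmul (\<psi> (single e 1)) (\<psi> u) = W\<^sub>2.tmul (single 0 [:k:]) (W\<^sub>2.tmul (\<psi> u) (\<psi> (single e 1)))"
    using e u by (simp add: W\<^sub>1.img_mult flip: mult smult)
  then show ?thesis using W\<^sub>2.skew_commute_keys \<psi> n by metis
qed

lemma q_relation:
  assumes "has_degree (\<psi> W\<^sub>1.S) sd sa sb" "has_degree (\<psi> W\<^sub>1.T) td ta tb"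
  shows "q\<^sub>1 = q\<^sub>2 powi (int (sa * tb) - int (sb * ta))"
proof -
  obtain f g where f: "f \<noteq> 0" "\<psi> W\<^sub>1.S = single (0, int sd, int sa, int sb) f"
    and g: "g \<noteq> 0" "\<psi> W\<^sub>1.T = single (0, int td, int ta, int tb) g"
    using assms by (auto simp: has_degree_def)
  have "W\<^sub>2.cocycle (0, int sd, int sa, int sb) (0, int td, int ta, int tb)
      = [:q\<^sub>1:] * W\<^sub>2.cocycle (0, int td, int ta, int tb) (0, int sd, int sa, int sb)"
    using W\<^sub>1.generators_in_img(3,4)
    by (rule skew_commute_psi[OF _ _ _ f(2,1)]) (simp_all add: g W\<^sub>1.cocycle_tuple power_int_minus)
  then have "q\<^sub>2 powi (- (int sb * int ta)) = q\<^sub>1 * q\<^sub>2 powi (- (int tb * int sa))"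
    by (simp add: W\<^sub>2.cocycle_tuple)
  then show ?thesis
    by (simp add: power_int_diff power_int_minus field_simps)
qed

lemma Z_commutes:
  assumes "has_degree (\<psi> W\<^sub>1.Z) zd za zb"
  shows "has_degree (\<psi> W\<^sub>1.S) sd sa sb \<Longrightarrow> zb * sa = sb * za"
    and "has_degree (\<psi> W\<^sub>1.T) sd sa sb \<Longrightarrow> zb * sa = sb * za"
proof -
  obtain f where f: "f \<noteq> 0" "\<psi> W\<^sub>1.Z = single (0, int zd, int za, int zb) f"
    using assms by (auto simp: has_degree_def)
  have "zb * sa = sb * za"
    if u: "single (0, 0, a, b) 1 \<in> W\<^sub>1.img" and deg: "has_degree (\<psi> (single (0, 0, a, b) 1)) sd sa sb" for a b
  proof -
    obtain g where g: "g \<noteq> 0" "\<psi> (single (0, 0, a, b) 1) = single (0, int sd, int sa, int sb) g"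
      using deg by (auto simp: has_degree_def)
    have "W\<^sub>2.cocycle (0, int zd, int za, int zb) (0, int sd, int sa, int sb)
        = [:1:] * W\<^sub>2.cocycle (0, int sd, int sa, int sb) (0, int zd, int za, int zb)"
      using W\<^sub>1.Z_in_img u by (rule skew_commute_psi[OF _ _ _ f(2,1)]) (simp_all add: g W\<^sub>1.cocycle_tuple)
    then have "q\<^sub>2 powi (- (int zb * int sa)) = q\<^sub>2 powi (- (int sb * int za))"
      by (simp add: W\<^sub>2.cocycle_tuple)
    then have "int zb * int sa = int sb * int za" by (simp only: W\<^sub>2.q_power_inject)
    then show ?thesis by (simp flip: of_nat_mult)
  qed
  then show "has_degree (\<psi> W\<^sub>1.S) sd sa sb \<Longrightarrow> zb * sa = sb * za"
    and "has_degree (\<psi> W\<^sub>1.T) sd sa sb \<Longrightarrow> zb * sa = sb * za"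
    using W\<^sub>1.generators_in_img(3,4) by blast+
qed

text \<open>If \<open>\<psi>(z)\<close> involved \<open>s\<close> or \<open>t\<close>, then \<open>\<psi>(s)\<close> and \<open>\<psi>(t)\<close>, which commute with it, would have proportional \<open>(s, t)\<close>-degrees
  and hence commute with each other, which is excluded by \<open>q\<^sub>1 \<noteq> 1\<close>.\<close>

lemma Z_degree:
  assumes Z: "has_degree (\<psi> W\<^sub>1.Z) zd za zb" and S: "has_degree (\<psi> W\<^sub>1.S) sd sa sb"
    and T: "has_degree (\<psi> W\<^sub>1.T) td ta tb"
  shows "za = 0 \<and> zb = 0"
proof (rule ccontr)
  assume "\<not> (za = 0 \<and> zb = 0)"
  have zs: "zb * sa = sb * za" and zt: "zb * ta = tb * za" using Z_commutes[OF Z] S T by blast+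
  have "za * (sa * tb) = za * (sb * ta)" using zs zt by (metis mult.assoc mult.commute)
  moreover have "zb * (sa * tb) = zb * (sb * ta)" using zs zt by (metis mult.assoc mult.commute)
  ultimately have "sa * tb = sb * ta" using \<open>\<not> (za = 0 \<and> zb = 0)\<close> by auto
  then have "q\<^sub>1 = 1" using q_relation[OF S T] by simp
  then show False using W\<^sub>1.q_generic by (auto simp: root_of_unity_def)
qed

lemma p_relation:
  assumes "\<psi> W\<^sub>1.Z = single (0, 1, 0, 0) f" "f \<noteq> 0"
  shows "(i, d, a, b) \<in> keys (\<psi> W\<^sub>1.X) \<Longrightarrow> p\<^sub>1 = p\<^sub>2 powi i"
    and "(i, d, a, b) \<in> keys (\<psi> W\<^sub>1.Y) \<Longrightarrow> p\<^sub>1 = p\<^sub>2 powi (- i)"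
proof -
  assume n: "(i, d, a, b) \<in> keys (\<psi> W\<^sub>1.X)"
  have "W\<^sub>2.cocycle (0, 1, 0, 0) (i, d, a, b) = [:inverse p\<^sub>1:] * W\<^sub>2.cocycle (i, d, a, b) (0, 1, 0, 0)"
    using W\<^sub>1.Z_in_img W\<^sub>1.generators_in_img(1)
    by (rule skew_commute_psi[OF _ _ _ assms n]) (simp_all add: W\<^sub>1.cocycle_tuple flip: one_pCons)
  from arg_cong[OF this, of "\<lambda>r. Polynomial.coeff r 0"]
  show "p\<^sub>1 = p\<^sub>2 powi i" by (simp add: W\<^sub>2.cocycle_tuple field_simps)
next
  assume n: "(i, d, a, b) \<in> keys (\<psi> W\<^sub>1.Y)"
  have "W\<^sub>2.cocycle (0, 1, 0, 0) (i, d, a, b) = [:p\<^sub>1:] * W\<^sub>2.cocycle (i, d, a, b) (0, 1, 0, 0)"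
    using W\<^sub>1.Z_in_img W\<^sub>1.generators_in_img(2)
  proof (rule skew_commute_psi[OF _ _ _ assms n])
    show "W\<^sub>1.cocycle (0, 1, 0, 0) n = [:p\<^sub>1:] * W\<^sub>1.cocycle n (0, 1, 0, 0)" if "n \<in> keys W\<^sub>1.Y" for n
      using W\<^sub>1.keys_Y[OF that] by (auto simp: W\<^sub>1.cocycle_tuple power_int_minus)
  qed
  from arg_cong[OF this, of "\<lambda>r. Polynomial.coeff r 0"]
  have "p\<^sub>1 * p\<^sub>2 powi i = 1" by (simp add: W\<^sub>2.cocycle_tuple mult.commute)
  then show "p\<^sub>1 = p\<^sub>2 powi (- i)" by (simp add: power_int_minus field_simps)
qed

text \<open>For an exponent \<open>(i, d, a, b)\<close> of \<open>\<psi>(x)\<close> and an exponent \<open>(- i, d', a', b')\<close> of \<open>\<psi>(y)\<close>, commutation with \<open>\<psi>(g)\<close>, say of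
  degree that of \<open>s\<close>, reads \<open>l\<^sub>2\<^sup>i = k q\<^sub>2\<^sup>-\<^sup>b\<close> and \<open>l\<^sub>2\<^sup>-\<^sup>i = k\<^sup>-\<^sup>1 q\<^sub>2\<^sup>-\<^sup>b\<^sup>'\<close>. Multiplying gives \<open>b + b' = 0\<close>, and since both
  exponents are nonnegative, the power of \<open>q\<^sub>2\<close> disappears.\<close>

lemma scaling_relation:
  assumes Z: "\<psi> W\<^sub>1.Z = single (0, 1, 0, 0) f" "f \<noteq> 0"
    and e: "single e 1 \<in> W\<^sub>1.img" and g: "\<psi> (single e 1) = single e' g" "g \<noteq> 0"
    and X: "W\<^sub>1.cocycle e (1, 0, 0, 0) = [:k:] * W\<^sub>1.cocycle (1, 0, 0, 0) e"
    and Y: "\<And>n. n \<in> keys W\<^sub>1.Y \<Longrightarrow> W\<^sub>1.cocycle e n = [:inverse k:] * W\<^sub>1.cocycle n e"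
    and i: "p\<^sub>1 = p\<^sub>2 powi i" and k: "k \<noteq> 0"
  shows "e' = (0, 0, 1, 0) \<Longrightarrow> k = l\<^sub>2 powi i" and "e' = (0, 0, 0, 1) \<Longrightarrow> k = m\<^sub>2 powi i"
proof -
  have nonempty: "\<exists>n. n \<in> keys (\<psi> u)" if "u \<in> W\<^sub>1.img" "u \<noteq> 0" for u
    using psi_nonzero[OF that] by (auto simp: poly_mapping_eq_iff fun_eq_iff in_keys_iff)
  have "W\<^sub>1.Y \<noteq> 0" using W\<^sub>1.lookup_val_y_power[of 1] by (auto simp: W\<^sub>1.T.ev_ncvar)
  then obtain i' d' a' b' where n': "(i', d', a', b') \<in> keys (\<psi> W\<^sub>1.Y)"
    using nonempty[OF W\<^sub>1.generators_in_img(2)] by auto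
  obtain i'' d a b where "(i'', d, a, b) \<in> keys (\<psi> W\<^sub>1.X)"
    using nonempty[OF W\<^sub>1.generators_in_img(1)] by (auto simp: single_eq_zero_iff)
  moreover from this have "i'' = i" using p_relation(1)[OF Z] i by auto
  ultimately have n: "(i, d, a, b) \<in> keys (\<psi> W\<^sub>1.X)" by simp
  have i': "i' = - i" using p_relation(2)[OF Z n'] i by (simp del: power_int_minus_left)
  have nonneg: "0 \<le> a" "0 \<le> b" "0 \<le> a'" "0 \<le> b'"
    using W\<^sub>2.img_keys_nonneg[OF psi_in_img[OF W\<^sub>1.generators_in_img(1)] n]
      W\<^sub>2.img_keys_nonneg[OF psi_in_img[OF W\<^sub>1.generators_in_img(2)] n'] by simp_all
  have x: "W\<^sub>2.cocycle e' (i, d, a, b) = [:k:] * W\<^sub>2.cocycle (i, d, a, b) e'"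
    by (rule skew_commute_psi[OF e W\<^sub>1.generators_in_img(1) _ g n]) (simp add: X)
  have y: "W\<^sub>2.cocycle e' (- i, d', a', b') = [:inverse k:] * W\<^sub>2.cocycle (- i, d', a', b') e'"
    using skew_commute_psi[OF e W\<^sub>1.generators_in_img(2) Y g n'] by (simp add: i')
  {
    assume e': "e' = (0, 0, 1, 0)"
    have x': "l\<^sub>2 powi i = k * q\<^sub>2 powi (- b)" and "l\<^sub>2 powi (- i) = inverse k * q\<^sub>2 powi (- b')"
      using x y by (simp_all add: e' W\<^sub>2.cocycle_tuple)
    then have "1 = q\<^sub>2 powi (- b) * q\<^sub>2 powi (- b')" using k by (simp add: power_int_minus field_simps)
    then have "q\<^sub>2 powi (- b + - b') = 1" by (simp only: power_int_add W\<^sub>2.q_nonzero disj_not1 not_False_eq_True simp_thms)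
    then have "b = 0" using nonneg by (simp only: W\<^sub>2.q_power_eq_one)
    then show "k = l\<^sub>2 powi i" using x' by simp
  }
  {
    assume e': "e' = (0, 0, 0, 1)"
    have x': "m\<^sub>2 powi i * q\<^sub>2 powi (- a) = k" and "m\<^sub>2 powi (- i) * q\<^sub>2 powi (- a') = inverse k"
      using x y by (simp_all add: e' W\<^sub>2.cocycle_tuple)
    then have "1 = q\<^sub>2 powi (- a) * q\<^sub>2 powi (- a')" using k by (simp add: power_int_minus field_simps)
    then have "q\<^sub>2 powi (- a + - a') = 1" by (simp only: power_int_add W\<^sub>2.q_nonzero disj_not1 not_False_eq_True simp_thms)
    then have "a = 0" using nonneg by (simp only: W\<^sub>2.q_power_eq_one)
    then show "k = m\<^sub>2 powi i" using x' by simp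
  }
qed

text \<open>The degree matrix of \<open>\<psi>\<close> has first row \<open>(d, 0, 0)\<close>, and that of \<open>\<psi>\<^sup>-\<^sup>1\<close> is a right inverse of it. So the corner
  entries of both are \<open>1\<close>, the zeros below the corner of the product force the rest of the first column to vanish,
  and the remaining \<open>2 \<times> 2\<close> blocks are again inverse to each other.\<close>

lemma psi_degrees:
  "has_degree (\<psi> W\<^sub>1.Z) 1 0 0 \<and>
   (has_degree (\<psi> W\<^sub>1.S) 0 1 0 \<and> has_degree (\<psi> W\<^sub>1.T) 0 0 1 \<or>
    has_degree (\<psi> W\<^sub>1.S) 0 0 1 \<and> has_degree (\<psi> W\<^sub>1.T) 0 1 0)"
proof -
  let ?\<phi> = "inv_into W\<^sub>1.img \<psi>"
  interpret I: weyl_isomorphism p\<^sub>2 l\<^sub>2 m\<^sub>2 q\<^sub>2 p\<^sub>1 l\<^sub>1 m\<^sub>1 q\<^sub>1 ?\<phi>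
    by (rule inverse_isomorphism)
  have deg: "\<exists>d a b. has_degree (\<psi> u) d a b" if "W\<^sub>1.normal u" for u
    using normal_psi[OF that] by (rule W\<^sub>2.normal_has_degree)
  have deg': "\<exists>d a b. has_degree (?\<phi> u) d a b" if "W\<^sub>2.normal u" for u
    using I.normal_psi[OF that] by (rule W\<^sub>1.normal_has_degree)
  obtain zd za zb where Z: "has_degree (\<psi> W\<^sub>1.Z) zd za zb" using deg[OF W\<^sub>1.normal_Z] by blast
  obtain sd sa sb where S: "has_degree (\<psi> W\<^sub>1.S) sd sa sb" using deg[OF W\<^sub>1.normal_S] by blast
  obtain td ta tb where T: "has_degree (\<psi> W\<^sub>1.T) td ta tb" using deg[OF W\<^sub>1.normal_T] by blast
  obtain zd' za' zb' where Z': "has_degree (?\<phi> W\<^sub>2.Z) zd' za' zb'" using deg'[OF W\<^sub>2.normal_Z] by blast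
  obtain sd' sa' sb' where S': "has_degree (?\<phi> W\<^sub>2.S) sd' sa' sb'" using deg'[OF W\<^sub>2.normal_S] by blast
  obtain td' ta' tb' where T': "has_degree (?\<phi> W\<^sub>2.T) td' ta' tb'" using deg'[OF W\<^sub>2.normal_T] by blast
  have inv: "?\<phi> (\<psi> u) = u" if "u \<in> W\<^sub>1.img" for u
    using bij that by (rule bij_betw_inv_into_left)
  have one: "has_degree (W\<^sub>1.Z) 1 0 0" "has_degree (W\<^sub>1.S) 0 1 0" "has_degree (W\<^sub>1.T) 0 0 1"
    by (auto simp: has_degree_def intro: exI[of _ 1])
  have z: "za = 0 \<and> zb = 0" by (rule Z_degree[OF Z S T])
  note comp = I.psi_has_degree[OF Z' S' T']
  have "zd * zd' + za * sd' + zb * td' = 1"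
    using has_degree_unique[OF comp[OF Z, unfolded inv[OF W\<^sub>1.Z_in_img]] one(1)] by blast
  then have zd: "zd = 1" "zd' = 1" using z by simp_all
  have s: "sd * zd' + sa * sd' + sb * td' = 0" "sd * za' + sa * sa' + sb * ta' = 1" "sd * zb' + sa * sb' + sb * tb' = 0"
    using has_degree_unique[OF comp[OF S, unfolded inv[OF W\<^sub>1.generators_in_img(3)]] one(2)] by blast+
  have t: "td * zd' + ta * sd' + tb * td' = 0" "td * za' + ta * sa' + tb * ta' = 0" "td * zb' + ta * sb' + tb * tb' = 1"
    using has_degree_unique[OF comp[OF T, unfolded inv[OF W\<^sub>1.generators_in_img(4)]] one(3)] by blast+
  have "sd = 0" "td = 0" using s(1) t(1) zd by simp_all
  moreover from this have "sa = 1 \<and> sb = 0 \<and> ta = 0 \<and> tb = 1 \<or> sa = 0 \<and> sb = 1 \<and> ta = 1 \<and> tb = 0"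
    using s t by (intro nat_matrix_inverse_cases[of sa sa' sb ta' sb' tb' ta tb]) simp_all
  ultimately show ?thesis using Z S T z zd by auto
qed

lemma ex_p_relation: "\<exists>i. p\<^sub>1 = p\<^sub>2 powi i"
proof -
  obtain f where "\<psi> W\<^sub>1.Z = single (0, 1, 0, 0) f" "f \<noteq> 0"
    using psi_degrees by (auto simp: has_degree_def)
  moreover have "\<psi> W\<^sub>1.X \<noteq> 0"
    using psi_nonzero[OF W\<^sub>1.generators_in_img(1)] by (auto simp: single_eq_zero_iff)
  then obtain i d a b where "(i, d, a, b) \<in> keys (\<psi> W\<^sub>1.X)"
    by (auto simp: poly_mapping_eq_iff fun_eq_iff in_keys_iff)
  ultimately show ?thesis using p_relation(1) by blast
qed

text \<open>By symmetry \<open>p\<^sub>2\<close> is also a power of \<open>p\<^sub>1\<close>, and the product of the two exponents must be \<open>1\<close>.\<close>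

lemma p_cases:
  assumes "p\<^sub>1 = p\<^sub>2 powi i"
  shows "i = 1 \<or> i = - 1"
proof -
  interpret I: weyl_isomorphism p\<^sub>2 l\<^sub>2 m\<^sub>2 q\<^sub>2 p\<^sub>1 l\<^sub>1 m\<^sub>1 q\<^sub>1 "inv_into W\<^sub>1.img \<psi>"
    by (rule inverse_isomorphism)
  obtain j where "p\<^sub>2 = p\<^sub>1 powi j" using I.ex_p_relation by blast
  then have "p\<^sub>2 powi (i * j) = p\<^sub>2 powi 1" using assms by (simp add: power_int_mult)
  then have "i * j = 1" by (simp only: W\<^sub>2.p_power_inject)
  then show ?thesis by (auto simp: zmult_eq_1_iff)
qed

lemma parameters_determined:
  obtains i :: int where "i = 1 \<or> i = - 1" "p\<^sub>1 = p\<^sub>2 powi i"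
    "q\<^sub>1 = q\<^sub>2 \<and> l\<^sub>1 = l\<^sub>2 powi i \<and> m\<^sub>1 = m\<^sub>2 powi i \<or>
     q\<^sub>1 = inverse q\<^sub>2 \<and> l\<^sub>1 = m\<^sub>2 powi i \<and> m\<^sub>1 = l\<^sub>2 powi i"
proof -
  obtain i where i: "p\<^sub>1 = p\<^sub>2 powi i" using ex_p_relation by blast
  obtain f where Z: "\<psi> W\<^sub>1.Z = single (0, 1, 0, 0) f" "f \<noteq> 0"
    using psi_degrees by (auto simp: has_degree_def)
  have X: "W\<^sub>1.cocycle (0, 0, 1, 0) (1, 0, 0, 0) = [:l\<^sub>1:] * W\<^sub>1.cocycle (1, 0, 0, 0) (0, 0, 1, 0)"
    "W\<^sub>1.cocycle (0, 0, 0, 1) (1, 0, 0, 0) = [:m\<^sub>1:] * W\<^sub>1.cocycle (1, 0, 0, 0) (0, 0, 0, 1)"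
    by (simp_all add: W\<^sub>1.cocycle_tuple)
  have Y: "W\<^sub>1.cocycle (0, 0, 1, 0) n = [:inverse l\<^sub>1:] * W\<^sub>1.cocycle n (0, 0, 1, 0)"
    "W\<^sub>1.cocycle (0, 0, 0, 1) n = [:inverse m\<^sub>1:] * W\<^sub>1.cocycle n (0, 0, 0, 1)" if "n \<in> keys W\<^sub>1.Y" for n
    using W\<^sub>1.keys_Y[OF that] by (auto simp: W\<^sub>1.cocycle_tuple power_int_minus)
  note rel_l = scaling_relation[OF Z W\<^sub>1.generators_in_img(3) _ _ X(1) Y(1) i W\<^sub>1.l_nonzero]
  note rel_m = scaling_relation[OF Z W\<^sub>1.generators_in_img(4) _ _ X(2) Y(2) i W\<^sub>1.m_nonzero]
  from psi_degrees
  consider "has_degree (\<psi> W\<^sub>1.S) 0 1 0" "has_degree (\<psi> W\<^sub>1.T) 0 0 1"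
    | "has_degree (\<psi> W\<^sub>1.S) 0 0 1" "has_degree (\<psi> W\<^sub>1.T) 0 1 0" by blast
  then have "q\<^sub>1 = q\<^sub>2 \<and> l\<^sub>1 = l\<^sub>2 powi i \<and> m\<^sub>1 = m\<^sub>2 powi i \<or>
     q\<^sub>1 = inverse q\<^sub>2 \<and> l\<^sub>1 = m\<^sub>2 powi i \<and> m\<^sub>1 = l\<^sub>2 powi i"
  proof cases
    case 1
    then obtain g h where g: "\<psi> W\<^sub>1.S = single (0, 0, 1, 0) g" "g \<noteq> 0"
      and h: "\<psi> W\<^sub>1.T = single (0, 0, 0, 1) h" "h \<noteq> 0" by (auto simp: has_degree_def)
    have "l\<^sub>1 = l\<^sub>2 powi i" using rel_l(1)[OF g] by simp
    moreover have "m\<^sub>1 = m\<^sub>2 powi i" using rel_m(2)[OF h] by simp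
    ultimately show ?thesis using q_relation[OF 1] by simp
  next
    case 2
    then obtain g h where g: "\<psi> W\<^sub>1.S = single (0, 0, 0, 1) g" "g \<noteq> 0"
      and h: "\<psi> W\<^sub>1.T = single (0, 0, 1, 0) h" "h \<noteq> 0" by (auto simp: has_degree_def)
    have "l\<^sub>1 = m\<^sub>2 powi i" using rel_l(2)[OF g] by simp
    moreover have "m\<^sub>1 = l\<^sub>2 powi i" using rel_m(1)[OF h] by simp
    ultimately show ?thesis using q_relation[OF 2] by (simp add: power_int_minus)
  qed
  with p_cases[OF i] i show ?thesis by (rule that)
qed

end

lemma weyl_isomorphism_of_alg_iso:
  fixes p\<^sub>1 p\<^sub>2 q\<^sub>1 q\<^sub>2 l\<^sub>1 l\<^sub>2 m\<^sub>1 m\<^sub>2 :: "'k::field"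
  assumes "weyl_parameters p\<^sub>1 l\<^sub>1 m\<^sub>1 q\<^sub>1" "weyl_parameters p\<^sub>2 l\<^sub>2 m\<^sub>2 q\<^sub>2"
    and "alg_isomorphic (poly_alg (weyl_alg p\<^sub>1 l\<^sub>1 m\<^sub>1 q\<^sub>1)) (poly_alg (weyl_alg p\<^sub>2 l\<^sub>2 m\<^sub>2 q\<^sub>2))"
  shows "\<exists>\<psi>. weyl_isomorphism p\<^sub>1 l\<^sub>1 m\<^sub>1 q\<^sub>1 p\<^sub>2 l\<^sub>2 m\<^sub>2 q\<^sub>2 \<psi>"
proof -
  interpret W\<^sub>1: weyl_parameters p\<^sub>1 l\<^sub>1 m\<^sub>1 q\<^sub>1 by fact
  interpret W\<^sub>2: weyl_parameters p\<^sub>2 l\<^sub>2 m\<^sub>2 q\<^sub>2 by fact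
  obtain h where h: "h \<in> ring_iso W\<^sub>1.B W\<^sub>2.B"
    and h_smult: "\<And>c f. f \<in> carrier W\<^sub>1.B \<Longrightarrow> h (c \<odot>\<^bsub>W\<^sub>1.B\<^esub> f) = c \<odot>\<^bsub>W\<^sub>2.B\<^esub> h f"
    using assms(3) by (auto simp: alg_isomorphic_def alg_iso_def)
  note hD = ring_iso_memE[OF h]
  define \<psi> where "\<psi> u = W\<^sub>2.embed (h (inv_into (carrier W\<^sub>1.B) W\<^sub>1.embed u))" for u
  have \<psi>: "\<psi> (W\<^sub>1.embed f) = W\<^sub>2.embed (h f)" if "f \<in> carrier W\<^sub>1.B" for f
    using that by (simp add: \<psi>_def inv_into_f_f W\<^sub>1.inj_on_embed)
  have bij\<^sub>1: "bij_betw (inv_into (carrier W\<^sub>1.B) W\<^sub>1.embed) W\<^sub>1.img (carrier W\<^sub>1.B)"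
    by (rule bij_betw_inv_into) (simp add: bij_betw_def W\<^sub>1.inj_on_embed W\<^sub>1.img_def)
  have bij\<^sub>2: "bij_betw W\<^sub>2.embed (carrier W\<^sub>2.B) W\<^sub>2.img"
    by (simp add: bij_betw_def W\<^sub>2.inj_on_embed W\<^sub>2.img_def)
  have "weyl_isomorphism p\<^sub>1 l\<^sub>1 m\<^sub>1 q\<^sub>1 p\<^sub>2 l\<^sub>2 m\<^sub>2 q\<^sub>2 \<psi>"
  proof
    show "bij_betw \<psi> W\<^sub>1.img W\<^sub>2.img"
      using bij_betw_trans[OF bij_betw_trans[OF bij\<^sub>1 hD(5)] bij\<^sub>2] by (simp add: \<psi>_def[abs_def] o_def)
    fix u assume "u \<in> W\<^sub>1.img"
    then obtain f where f: "f \<in> carrier W\<^sub>1.B" "u = W\<^sub>1.embed f" by (auto simp: W\<^sub>1.img_def)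
    show "\<psi> (W\<^sub>1.tmul u v) = W\<^sub>2.tmul (\<psi> u) (\<psi> v)" if v: "v \<in> W\<^sub>1.img" for v
    proof -
      obtain g where g: "g \<in> carrier W\<^sub>1.B" "v = W\<^sub>1.embed g" using v by (auto simp: W\<^sub>1.img_def)
      have fg: "f \<otimes>\<^bsub>W\<^sub>1.B\<^esub> g \<in> carrier W\<^sub>1.B"
        using f g by (intro ring.ring_simprules(5)[OF W\<^sub>1.ring_B])
      have "\<psi> (W\<^sub>1.tmul u v) = \<psi> (W\<^sub>1.embed (f \<otimes>\<^bsub>W\<^sub>1.B\<^esub> g))"
        using f g by (simp add: W\<^sub>1.embed_mult)
      also have "\<dots> = W\<^sub>2.embed (h f \<otimes>\<^bsub>W\<^sub>2.B\<^esub> h g)" using f g by (simp only: \<psi>[OF fg] hD(2))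
      also have "\<dots> = W\<^sub>2.tmul (\<psi> u) (\<psi> v)"
        using f g hD(1) by (simp add: W\<^sub>2.embed_mult \<psi>)
      finally show ?thesis .
    qed
    show "\<psi> (W\<^sub>1.tmul (single 0 [:r:]) u) = W\<^sub>2.tmul (single 0 [:r:]) (\<psi> u)" for r
    proof -
      have rf: "r \<odot>\<^bsub>W\<^sub>1.B\<^esub> f \<in> carrier W\<^sub>1.B" by (rule W\<^sub>1.B_smult_closed[OF f(1)])
      have "\<psi> (W\<^sub>1.tmul (single 0 [:r:]) u) = \<psi> (W\<^sub>1.embed (r \<odot>\<^bsub>W\<^sub>1.B\<^esub> f))"
        using f by (simp add: W\<^sub>1.embed_smult)
      also have "\<dots> = W\<^sub>2.embed (r \<odot>\<^bsub>W\<^sub>2.B\<^esub> h f)" using f by (simp only: \<psi>[OF rf] h_smult)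
      also have "\<dots> = W\<^sub>2.tmul (single 0 [:r:]) (\<psi> u)"
        using f hD(1) by (simp add: W\<^sub>2.embed_smult \<psi>)
      finally show ?thesis .
    qed
  qed
  then show ?thesis by (rule exI[where x = \<psi>])
qed

theorem theorem2p5:
  fixes p\<^sub>1 p\<^sub>2 q\<^sub>1 q\<^sub>2 l\<^sub>1 l\<^sub>2 m\<^sub>1 m\<^sub>2 :: "'k::field"
  assumes "p\<^sub>1 \<noteq> 0" "q\<^sub>1 \<noteq> 0" "l\<^sub>1 \<noteq> 0" "m\<^sub>1 \<noteq> 0"
    and "p\<^sub>2 \<noteq> 0" "q\<^sub>2 \<noteq> 0" "l\<^sub>2 \<noteq> 0" "m\<^sub>2 \<noteq> 0"
    and "\<not> root_of_unity p\<^sub>1" "\<not> root_of_unity p\<^sub>2"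
    and "\<not> root_of_unity q\<^sub>1" "\<not> root_of_unity q\<^sub>2"
  shows "alg_isomorphic (poly_alg (weyl_alg p\<^sub>1 l\<^sub>1 m\<^sub>1 q\<^sub>1)) (poly_alg (weyl_alg p\<^sub>2 l\<^sub>2 m\<^sub>2 q\<^sub>2)) \<longleftrightarrow>
      (p\<^sub>1 = p\<^sub>2 \<and> q\<^sub>1 = q\<^sub>2 \<and> l\<^sub>1 = l\<^sub>2 \<and> m\<^sub>1 = m\<^sub>2) \<or>
      (p\<^sub>1 = inverse p\<^sub>2 \<and> q\<^sub>1 = q\<^sub>2 \<and> l\<^sub>1 = inverse l\<^sub>2 \<and> m\<^sub>1 = inverse m\<^sub>2) \<or>
      (p\<^sub>1 = p\<^sub>2 \<and> q\<^sub>1 = inverse q\<^sub>2 \<and> l\<^sub>1 = m\<^sub>2 \<and> l\<^sub>2 = m\<^sub>1) \<or>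
      (p\<^sub>1 = inverse p\<^sub>2 \<and> q\<^sub>1 = inverse q\<^sub>2 \<and> l\<^sub>1 = inverse m\<^sub>2 \<and> l\<^sub>2 = inverse m\<^sub>1)"
    (is "?iso \<longleftrightarrow> ?id \<or> ?xy \<or> ?st \<or> ?both")
proof
  assume iso: ?iso
  have "weyl_parameters p\<^sub>1 l\<^sub>1 m\<^sub>1 q\<^sub>1" "weyl_parameters p\<^sub>2 l\<^sub>2 m\<^sub>2 q\<^sub>2"
    using assms by (simp_all add: weyl_parameters_def)
  from weyl_isomorphism_of_alg_iso[OF this iso]
  obtain \<psi> where "weyl_isomorphism p\<^sub>1 l\<^sub>1 m\<^sub>1 q\<^sub>1 p\<^sub>2 l\<^sub>2 m\<^sub>2 q\<^sub>2 \<psi>" ..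
  then interpret weyl_isomorphism p\<^sub>1 l\<^sub>1 m\<^sub>1 q\<^sub>1 p\<^sub>2 l\<^sub>2 m\<^sub>2 q\<^sub>2 \<psi> .
  show "?id \<or> ?xy \<or> ?st \<or> ?both"
    by (rule parameters_determined) (auto simp: power_int_minus)
next
  have poly: "alg_isomorphic (poly_alg (weyl_alg p l m q)) (poly_alg (weyl_alg p' l' m' q'))"
    if "alg_isomorphic (weyl_alg p l m q) (weyl_alg p' l' m' q')" for p l m q p' l' m' q' :: 'k
    using that by (intro alg_isomorphic_poly_alg ring_weyl_alg)
  assume "?id \<or> ?xy \<or> ?st \<or> ?both"
  then consider ?id | ?xy | ?st | ?both by blast
  then show ?iso
  proof cases
    case 1
    then show ?thesis by (simp add: alg_isomorphic_refl)
  next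
    case 2
    then show ?thesis using poly[OF weyl_alg_exchange_xy[OF assms(1), of l\<^sub>1 m\<^sub>1 q\<^sub>1]] by simp
  next
    case 3
    then show ?thesis using poly[OF weyl_alg_exchange_st[OF assms(2), of p\<^sub>1 l\<^sub>1 m\<^sub>1]] by simp
  next
    case 4
    then show ?thesis
      using poly[OF alg_isomorphic_trans[OF weyl_alg_exchange_xy[OF assms(1), of l\<^sub>1 m\<^sub>1 q\<^sub>1]
            weyl_alg_exchange_st[OF assms(2)]]] by simp
  qed
qed

end
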